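(* Let $1\le p\le2$, let $\mathcal{S}_p(\mathcal{H}_1,\mathcal{H}_2)$ be the Schatten-$p$ class of operators mapping the separable Hilbert space $\mathcal{H}_1$ to the separable Hilbert space $\mathcal{H}_2$, let $\Psi_n$ be an $\mathcal{A}_n$-localised frame for $\mathcal{H}_n$, $n=1,2$ (with the constant weight $1$ being $\mathcal{A}_n$-admissible), and let $O:\mathcal{H}_1\to\mathcal{H}_2$ be a bounded operator with kernel $K$. If $K\in\mathfrak{H}^{2,p}(\Psi_1\otimes\Psi_2)$, then $O\in\mathcal{S}_p(\mathcal{H}_1,\mathcal{H}_2)$. In particular, if $K\in\mathcal{H}^{p,p}(\Psi_1\otimes\Psi_2)$, then $O\in\mathcal{S}_p(\mathcal{H}_1,\mathcal{H}_2)$.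
   Context: Conventions. Hilbert spaces are separable, with inner products linear in the first argument. Frames. A countable family $\Psi=\{\psi_i\}_{i\in I}\subset\mathcal{H}$ is a frame if $A\|f\|^2\le\sum_i|\langle f,\psi_i\rangle|^2\le B\|f\|^2$ for all $f\in\mathcal{H}$ and some $A,B>0$. $C_\Psi f=\{\langle f,\psi_i\rangle\}_{i}$, $D_\Psi c=\sum_i c_i\psi_i$, $S_\Psi=D_\Psi C_\Psi$; the canonical dual frame is $\widetilde\Psi=\{\widetilde\psi_i\}=\{S_\Psi^{-1}\psi_i\}$. The Gram matrix is $G_\Psi=(\langle\psi_{i'},\psi_i\rangle)_{(i,i')\in I^2}$. Localisation. A spectral matrix algebra $\mathcal{A}$ is an involutive Banach algebra of infinite matrices indexed by $I\times I$ (involution: conjugate transpose) such that (a) every $A\in\mathcal{A}$ defines a bounded operator on $\ell^2(I)$; (b) if $A\in\mathcal{A}$ is invertible in $B(\ell^2(I))$ then $A^{-1}\in\mathcal{A}$; (c) $\mathcal{A}$ is solid: $A\in\mathcal{A}$ and $|b_{i,j}|\le|a_{i,j}|$ for all $i,j$ imply $B\in\mathcal{A}$ and $\|B\|_{\mathcal{A}}\le\|A\|_{\mathcal{A}}$. A frame $\Psi$ is $\mathcal{A}$-localised if $G_\Psi\in\mathcal{A}$. A weight $w$ is $\mathcal{A}$-admissible if every $A\in\mathcal{A}$ defines a bounded operator on $\ell^p_w(I)$ (norm $\|c\cdot w\|_{\ell^p}$) for every $1\le p\le\infty$. Here $\mathcal{A}_1,\mathcal{A}_2$ are spectral matrix algebras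 over the index sets $I$ and $J$ of $\Psi_1=\{\psi_{1,i}\}_{i\in I}$ and $\Psi_2=\{\psi_{2,j}\}_{j\in J}$. Tensor products. $f_1\otimes f_2$ is the rank-one operator $f\mapsto\langle f,f_1\rangle f_2$; $\mathcal{H}_1\otimes\mathcal{H}_2$ is the Hilbert space completion of the span of simple tensors under $\langle f_1\otimes f_2,g_1\otimes g_2\rangle=\overline{\langle f_1,g_1\rangle}\langle f_2,g_2\rangle$. $\Psi_1\otimes\Psi_2=\{\psi_{1,i}\otimes\psi_{2,j}\}$ is a frame for it with canonical dual $\widetilde{\Psi_1\otimes\Psi_2}=\widetilde\Psi_1\otimes\widetilde\Psi_2$. Let $\mathcal{H}_{00}(\Psi_1\otimes\Psi_2)$ be the span of $\Psi_1\otimes\Psi_2$. $\mathcal{H}^{p,p}(\Psi_1\otimes\Psi_2)$ (unweighted) is its completion in the norm $\big(\sum_{i,j}|(C_{\widetilde{\Psi_1\otimes\Psi_2}}F)_{i,j}|^p\big)^{1/p}$, and $\mathfrak{H}^{2,p}(\Psi_1\otimes\Psi_2)$ is its completion in the norm $\big(\sum_{i\in I}\big(\sum_{j\in J}|(C_{\widetilde{\Psi_1\otimes\Psi_2}}F)_{i,j}|^2\big)^{p/2}\big)^{1/p}$. Here $(C_{\widetilde{\Psi_1\otimes\Psi_2}}F)_{i,j}=\langle F,\widetilde\psi_{1,i}\otimes\widetilde\psi_{2,j}\rangle$, extended by continuity. $\mathcal{H}^{\infty,\infty}(\Psi_1\otimes\Psi_2)$ is the space of equivalence classes of sequences $\{F_n\}\subset\mathcal{H}_1\otimes\mathcal{H}_2$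 for which $(C_{\widetilde{\Psi_1\otimes\Psi_2}}F)_{i,j}:=\lim_n\langle F_n,\widetilde\psi_{1,i}\otimes\widetilde\psi_{2,j}\rangle$ exists for all $(i,j)$ and $\sup_n\sup_{i,j}|\langle F_n,\widetilde\psi_{1,i}\otimes\widetilde\psi_{2,j}\rangle|<\infty$ (sequences being equivalent iff the coefficient limits of their difference vanish). All these spaces are regarded as subspaces of $\mathcal{H}^{\infty,\infty}(\Psi_1\otimes\Psi_2)$ via the coefficients. Kernel. $\mathcal{H}^1(\Psi_n)$ is the completion of the span of $\Psi_n$ in the norm $\|C_{\widetilde\Psi_n}f\|_{\ell^1}$; it is contained in $\mathcal{H}_n$. The kernel of $O$ is the unique $K\in\mathcal{H}^{\infty,\infty}(\Psi_1\otimes\Psi_2)$ with $\langle Of_1,f_2\rangle_{\mathcal{H}_2}=\langle K,f_1\otimes f_2\rangle$ for all $f_n\in\mathcal{H}^1(\Psi_n)$, where $\langle K,F\rangle=\sum_{i,j}(C_{\widetilde{\Psi_1\otimes\Psi_2}}K)_{i,j}\overline{\langle F,\psi_{1,i}\otimes\psi_{2,j}\rangle}$; in particular $(C_{\widetilde{\Psi_1\otimes\Psi_2}}K)_{i,j}=\langle O\widetilde\psi_{1,i},\widetilde\psi_{2,j}\rangle_{\mathcal{H}_2}$. *)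

theory Defs
  imports "HOL-Analysis.Analysis" "HOL-Library.Function_Algebras"
begin

section \<open>Complex vector spaces and complex Hilbert spaces\<close>

class complex_vector = ab_group_add +
  fixes scaleC :: "complex \<Rightarrow> 'a \<Rightarrow> 'a" (infixr "*\<^sub>C" 75)
  assumes scaleC_add_right: "a *\<^sub>C (x + y) = a *\<^sub>C x + a *\<^sub>C y"
    and scaleC_add_left: "(a + b) *\<^sub>C x = a *\<^sub>C x + b *\<^sub>C x"
    and scaleC_scaleC: "a *\<^sub>C (b *\<^sub>C x) = (a * b) *\<^sub>C x"
    and scaleC_one: "1 *\<^sub>C x = x"

text \<open>The inner product is linear in its first argument. Completeness comes from \<^class>\<open>banach\<close>.\<close>

class complex_hilbert_space = complex_vector + banach +
  fixes cinner :: "'a \<Rightarrow> 'a \<Rightarrow> complex"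
  assumes scaleR_scaleC: "scaleR r x = complex_of_real r *\<^sub>C x"
    and cinner_commute: "cinner x y = cnj (cinner y x)"
    and cinner_add_left: "cinner (x + y) z = cinner x z + cinner y z"
    and cinner_scaleC_left: "cinner (c *\<^sub>C x) y = c * cinner x y"
    and cinner_self: "cinner x x = complex_of_real ((norm x)\<^sup>2)"

instantiation complex :: complex_hilbert_space
begin
definition "scaleC c z = c * (z :: complex)"
definition "cinner z w = z * cnj (w :: complex)"
instance
  by standard
    (simp_all add: scaleC_complex_def cinner_complex_def algebra_simps scaleR_conv_of_real
      complex_norm_square del: of_real_power)
end

instantiation "fun" :: (type, complex_vector) complex_vector
begin
definition "scaleC c f = (\<lambda>x. c *\<^sub>C f x)"
instance
  by standard
    (simp_all add: scaleC_fun_def fun_eq_iff scaleC_add_right scaleC_add_left scaleC_scaleC scaleC_one)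
end

global_interpretation complex_vector: vector_space "scaleC :: complex \<Rightarrow> 'a \<Rightarrow> 'a::complex_vector"
  by standard (simp_all add: scaleC_add_right scaleC_add_left scaleC_scaleC scaleC_one)

abbreviation csubspace :: "'a::complex_vector set \<Rightarrow> bool"
  where "csubspace \<equiv> module.subspace scaleC"

abbreviation cspan :: "'a::complex_vector set \<Rightarrow> 'a set"
  where "cspan \<equiv> module.span scaleC"

definition bounded_clinear :: "('a::complex_hilbert_space \<Rightarrow> 'b::complex_hilbert_space) \<Rightarrow> bool"
  where "bounded_clinear T \<longleftrightarrow> bounded_linear T \<and> (\<forall>c x. T (c *\<^sub>C x) = c *\<^sub>C T x)"

section \<open>Schatten classes\<close>

definition orthonormal_on :: "nat set \<Rightarrow> (nat \<Rightarrow> 'a::complex_hilbert_space) \<Rightarrow> bool"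
  where "orthonormal_on N e \<longleftrightarrow> (\<forall>m\<in>N. \<forall>n\<in>N. cinner (e m) (e n) = of_bool (m = n))"

text \<open>
  Canonical (singular value) decomposition \<open>T x = \<Sum>\<^sub>n s\<^sub>n \<langle>x, e\<^sub>n\<rangle> f\<^sub>n\<close>; the family \<open>(s\<^sub>n)\<close>, \<open>n \<in> N\<close>,
  lists the nonzero singular values of \<open>T\<close> with multiplicity. The index set \<open>N\<close> is finite
  when \<open>T\<close> has finite rank.
\<close>

definition canonical_decomposition ::
    "('a::complex_hilbert_space \<Rightarrow> 'b::complex_hilbert_space) \<Rightarrow> nat set \<Rightarrow>
     (nat \<Rightarrow> real) \<Rightarrow> (nat \<Rightarrow> 'a) \<Rightarrow> (nat \<Rightarrow> 'b) \<Rightarrow> bool"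
  where "canonical_decomposition T N s e f \<longleftrightarrow>
    orthonormal_on N e \<and> orthonormal_on N f \<and> (\<forall>n\<in>N. 0 < s n) \<and>
    (\<forall>x. ((\<lambda>n. (complex_of_real (s n) * cinner x (e n)) *\<^sub>C f n) has_sum T x) N)"

definition compact_operator :: "('a::complex_hilbert_space \<Rightarrow> 'b::complex_hilbert_space) \<Rightarrow> bool"
  where "compact_operator T \<longleftrightarrow> bounded_clinear T \<and> compact (closure (T ` cball 0 1))"

definition schatten_class :: "real \<Rightarrow> ('a::complex_hilbert_space \<Rightarrow> 'b::complex_hilbert_space) set"
  where "schatten_class p = {T. compact_operator T \<and>
    (\<exists>N s e f. canonical_decomposition T N s e f \<and> (\<lambda>n. s n powr p) summable_on N)}"

section \<open>Sequence norms, with value \<open>\<infinity>\<close> outside the respective space\<close>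

definition epowr :: "ennreal \<Rightarrow> real \<Rightarrow> ennreal"
  where "epowr x r = (if x = \<infinity> then \<infinity> else ennreal (enn2real x powr r))"

definition lp_norm :: "real \<Rightarrow> ('i \<Rightarrow> complex) \<Rightarrow> ennreal"
  where "lp_norm p c = epowr (\<Sum>\<^sub>\<infinity>i. ennreal (cmod (c i) powr p)) (1 / p)"

definition linf_norm :: "('i \<Rightarrow> complex) \<Rightarrow> ennreal"
  where "linf_norm c = (SUP i. ennreal (cmod (c i)))"

definition l2p_norm :: "real \<Rightarrow> ('i \<Rightarrow> 'j \<Rightarrow> complex) \<Rightarrow> ennreal"
  where "l2p_norm p c =
    epowr (\<Sum>\<^sub>\<infinity>i. epowr (\<Sum>\<^sub>\<infinity>j. ennreal ((cmod (c i j))\<^sup>2)) (p / 2)) (1 / p)"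

definition lpp_norm :: "real \<Rightarrow> ('i \<Rightarrow> 'j \<Rightarrow> complex) \<Rightarrow> ennreal"
  where "lpp_norm p c = lp_norm p (\<lambda>(i, j). c i j)"

section \<open>Frames\<close>

definition is_frame :: "('i::countable \<Rightarrow> 'a::complex_hilbert_space) \<Rightarrow> bool"
  where "is_frame \<Psi> \<longleftrightarrow> (\<exists>A>0. \<exists>B>0. \<forall>f.
    (\<lambda>i. (cmod (cinner f (\<Psi> i)))\<^sup>2) summable_on UNIV \<and>
    A * (norm f)\<^sup>2 \<le> (\<Sum>\<^sub>\<infinity>i. (cmod (cinner f (\<Psi> i)))\<^sup>2) \<and>
    (\<Sum>\<^sub>\<infinity>i. (cmod (cinner f (\<Psi> i)))\<^sup>2) \<le> B * (norm f)\<^sup>2)"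

definition analysis_op :: "('i \<Rightarrow> 'a::complex_hilbert_space) \<Rightarrow> 'a \<Rightarrow> 'i \<Rightarrow> complex"
  where "analysis_op \<Psi> f = (\<lambda>i. cinner f (\<Psi> i))"

definition synthesis_op :: "('i \<Rightarrow> 'a::complex_hilbert_space) \<Rightarrow> ('i \<Rightarrow> complex) \<Rightarrow> 'a"
  where "synthesis_op \<Psi> c = (\<Sum>\<^sub>\<infinity>i. c i *\<^sub>C \<Psi> i)"

definition frame_op :: "('i \<Rightarrow> 'a::complex_hilbert_space) \<Rightarrow> 'a \<Rightarrow> 'a"
  where "frame_op \<Psi> = synthesis_op \<Psi> \<circ> analysis_op \<Psi>"

definition dual_frame :: "('i \<Rightarrow> 'a::complex_hilbert_space) \<Rightarrow> 'i \<Rightarrow> 'a"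
  where "dual_frame \<Psi> i = inv (frame_op \<Psi>) (\<Psi> i)"

section \<open>Spectral matrix algebras and localisation\<close>

type_synonym 'i cmatrix = "'i \<Rightarrow> 'i \<Rightarrow> complex"

definition mat_apply :: "'i cmatrix \<Rightarrow> ('i \<Rightarrow> complex) \<Rightarrow> 'i \<Rightarrow> complex"
  where "mat_apply A c = (\<lambda>i. \<Sum>\<^sub>\<infinity>j. A i j * c j)"

definition mat_mult :: "'i cmatrix \<Rightarrow> 'i cmatrix \<Rightarrow> 'i cmatrix"
  where "mat_mult A B = (\<lambda>i j. \<Sum>\<^sub>\<infinity>k. A i k * B k j)"

definition mat_one :: "'i cmatrix"
  where "mat_one = (\<lambda>i j. of_bool (i = j))"

definition mat_adjoint :: "'i cmatrix \<Rightarrow> 'i cmatrix"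
  where "mat_adjoint A = (\<lambda>i j. cnj (A j i))"

definition bounded_matrix_on :: "(('i \<Rightarrow> complex) \<Rightarrow> ennreal) \<Rightarrow> 'i cmatrix \<Rightarrow> bool"
  where "bounded_matrix_on nrm A \<longleftrightarrow> (\<exists>C::real. \<forall>c. nrm c < \<infinity> \<longrightarrow>
    (\<forall>i. (\<lambda>j. A i j * c j) summable_on UNIV) \<and> nrm (mat_apply A c) \<le> ennreal C * nrm c)"

text \<open>
  \<open>nrm\<close> is the norm of the algebra \<open>\<A>\<close>. Neither a unit nor isometry of the involution is demanded.
\<close>

definition involutive_banach_matrix_algebra :: "'i cmatrix set \<Rightarrow> ('i cmatrix \<Rightarrow> real) \<Rightarrow> bool"
  where "involutive_banach_matrix_algebra \<A> nrm \<longleftrightarrow>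
    csubspace \<A> \<and>
    (\<forall>A\<in>\<A>. 0 \<le> nrm A \<and> (nrm A = 0 \<longleftrightarrow> A = 0)) \<and>
    (\<forall>A\<in>\<A>. \<forall>B\<in>\<A>. nrm (A + B) \<le> nrm A + nrm B) \<and>
    (\<forall>c. \<forall>A\<in>\<A>. nrm (c *\<^sub>C A) = cmod c * nrm A) \<and>
    (\<forall>X. (\<forall>n. X n \<in> \<A>) \<and> (\<forall>\<epsilon>>0. \<exists>M. \<forall>m\<ge>M. \<forall>n\<ge>M. nrm (X m - X n) < \<epsilon>) \<longrightarrow>
      (\<exists>L\<in>\<A>. (\<lambda>n::nat. nrm (X n - L)) \<longlonglongrightarrow> 0)) \<and>
    (\<forall>A\<in>\<A>. \<forall>B\<in>\<A>. mat_mult A B \<in> \<A> \<and> nrm (mat_mult A B) \<le> nrm A * nrm B) \<and>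
    (\<forall>A\<in>\<A>. mat_adjoint A \<in> \<A>)"

definition spectral_matrix_algebra :: "'i::countable cmatrix set \<Rightarrow> ('i cmatrix \<Rightarrow> real) \<Rightarrow> bool"
  where "spectral_matrix_algebra \<A> nrm \<longleftrightarrow>
    involutive_banach_matrix_algebra \<A> nrm \<and>
    (\<forall>A\<in>\<A>. bounded_matrix_on (lp_norm 2) A) \<and>
    (\<forall>A\<in>\<A>. \<forall>B. bounded_matrix_on (lp_norm 2) B \<and> mat_mult A B = mat_one \<and> mat_mult B A = mat_one
      \<longrightarrow> B \<in> \<A>) \<and>
    (\<forall>A\<in>\<A>. \<forall>B. (\<forall>i j. cmod (B i j) \<le> cmod (A i j)) \<longrightarrow> B \<in> \<A> \<and> nrm B \<le> nrm A)"

definition gram_matrix :: "('i \<Rightarrow> 'a::complex_hilbert_space) \<Rightarrow> 'i cmatrix"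
  where "gram_matrix \<Psi> = (\<lambda>i i'. cinner (\<Psi> i') (\<Psi> i))"

definition localised_frame :: "'i::countable cmatrix set \<Rightarrow> ('i \<Rightarrow> 'a::complex_hilbert_space) \<Rightarrow> bool"
  where "localised_frame \<A> \<Psi> \<longleftrightarrow> is_frame \<Psi> \<and> gram_matrix \<Psi> \<in> \<A>"

definition admissible_weight :: "'i cmatrix set \<Rightarrow> ('i \<Rightarrow> real) \<Rightarrow> bool"
  where "admissible_weight \<A> w \<longleftrightarrow> (\<forall>i. 0 < w i) \<and>
    (\<forall>A\<in>\<A>. (\<forall>p\<ge>1. bounded_matrix_on (\<lambda>c. lp_norm p (\<lambda>i. c i * complex_of_real (w i))) A) \<and>
      bounded_matrix_on (\<lambda>c. linf_norm (\<lambda>i. c i * complex_of_real (w i))) A)"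

section \<open>Completions\<close>

text \<open>Completion of \<open>V\<close> in the norm \<open>nrm\<close>: Cauchy sequences in \<open>V\<close> modulo null sequences.\<close>

definition cauchy_seqs :: "'v::minus set \<Rightarrow> ('v \<Rightarrow> ennreal) \<Rightarrow> (nat \<Rightarrow> 'v) set"
  where "cauchy_seqs V nrm = {F. (\<forall>n. F n \<in> V) \<and>
    (\<forall>\<epsilon>>0. \<exists>M. \<forall>m\<ge>M. \<forall>n\<ge>M. nrm (F m - F n) < \<epsilon>)}"

definition null_equiv :: "'v::minus set \<Rightarrow> ('v \<Rightarrow> ennreal) \<Rightarrow> ((nat \<Rightarrow> 'v) \<times> (nat \<Rightarrow> 'v)) set"
  where "null_equiv V nrm = {(F, G). F \<in> cauchy_seqs V nrm \<and> G \<in> cauchy_seqs V nrm \<and>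
    (\<lambda>n. nrm (F n - G n)) \<longlonglongrightarrow> 0}"

definition completion :: "'v::minus set \<Rightarrow> ('v \<Rightarrow> ennreal) \<Rightarrow> (nat \<Rightarrow> 'v) set set"
  where "completion V nrm = cauchy_seqs V nrm // null_equiv V nrm"

section \<open>The Hilbert space tensor product\<close>

definition simple_tensor ::
    "'a::complex_hilbert_space \<Rightarrow> 'b::complex_hilbert_space \<Rightarrow> 'a \<Rightarrow> 'b" (infixr "\<otimes>\<^sub>t" 70)
  where "f1 \<otimes>\<^sub>t f2 = (\<lambda>f. cinner f f1 *\<^sub>C f2)"

definition alg_tensor :: "('a::complex_hilbert_space \<Rightarrow> 'b::complex_hilbert_space) set"
  where "alg_tensor = cspan {f1 \<otimes>\<^sub>t f2 | f1 f2. True}"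

definition sum_of_tensors ::
    "('a::complex_hilbert_space \<times> 'b::complex_hilbert_space) list \<Rightarrow> 'a \<Rightarrow> 'b"
  where "sum_of_tensors xs = (\<Sum>(f1, f2)\<leftarrow>xs. f1 \<otimes>\<^sub>t f2)"

text \<open>
  The sesquilinear extension of
  \<open>\<langle>f1 \<otimes> f2, g1 \<otimes> g2\<rangle> = cnj \<langle>f1, g1\<rangle> \<langle>f2, g2\<rangle>\<close> to \<^const>\<open>alg_tensor\<close>. Every element of
  \<^const>\<open>alg_tensor\<close> is a finite sum of simple tensors, since scalars can be absorbed in the second factor;
  independence of the representations is shown in \<open>tensor_inner_sum_of_tensors\<close>.
\<close>

definition tensor_inner ::
    "('a::complex_hilbert_space \<Rightarrow> 'b::complex_hilbert_space) \<Rightarrow> ('a \<Rightarrow> 'b) \<Rightarrow> complex"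
  where "tensor_inner F G = (THE z. \<exists>xs ys. F = sum_of_tensors xs \<and> G = sum_of_tensors ys \<and>
    z = (\<Sum>(f1, f2)\<leftarrow>xs. \<Sum>(g1, g2)\<leftarrow>ys. cnj (cinner f1 g1) * cinner f2 g2))"

definition tensor_norm :: "('a::complex_hilbert_space \<Rightarrow> 'b::complex_hilbert_space) \<Rightarrow> real"
  where "tensor_norm F = sqrt (Re (tensor_inner F F))"

type_synonym ('a, 'b) tensor = "(nat \<Rightarrow> 'a \<Rightarrow> 'b) set"

definition hilbert_tensor :: "('a::complex_hilbert_space, 'b::complex_hilbert_space) tensor set"
  where "hilbert_tensor = completion alg_tensor (\<lambda>F. ennreal (tensor_norm F))"

definition embed_tensor ::
    "('a::complex_hilbert_space \<Rightarrow> 'b::complex_hilbert_space) \<Rightarrow> ('a, 'b) tensor"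
  where "embed_tensor F = null_equiv alg_tensor (\<lambda>F. ennreal (tensor_norm F)) `` {\<lambda>n. F}"

definition hilbert_tensor_inner ::
    "('a::complex_hilbert_space, 'b::complex_hilbert_space) tensor \<Rightarrow> ('a, 'b) tensor \<Rightarrow> complex"
  where "hilbert_tensor_inner X Y =
    (THE z. \<exists>F\<in>X. \<exists>G\<in>Y. (\<lambda>n. tensor_inner (F n) (G n)) \<longlonglongrightarrow> z)"

lemma cinner_add_right: "cinner z (x + y) = cinner z x + cinner z (y :: 'a::complex_hilbert_space)"
  by (metis cinner_add_left cinner_commute complex_cnj_add)

lemma cinner_scaleC_right: "cinner x (c *\<^sub>C y) = cnj c * cinner x (y :: 'a::complex_hilbert_space)"
  by (metis cinner_scaleC_left cinner_commute complex_cnj_mult)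

lemma cinner_zero_left: "cinner 0 (x :: 'a::complex_hilbert_space) = 0"
  by (metis cinner_add_left add_cancel_right_right)

lemma cinner_zero_right: "cinner (x :: 'a::complex_hilbert_space) 0 = 0"
  by (metis cinner_add_right add_cancel_right_right)

lemma tensor_sum_left:
  "(\<Sum>(f1, f2)\<leftarrow>xs. \<Sum>(g1, g2)\<leftarrow>ys. cnj (cinner f1 g1) * cinner f2 g2) =
   (\<Sum>(g1, g2)\<leftarrow>ys. cinner (sum_of_tensors xs g1) g2)"
proof (induction xs)
  case Nil
  then show ?case by (simp add: sum_of_tensors_def cinner_zero_left case_prod_unfold)
next
  case (Cons x xs)
  have "cnj (cinner (fst x) g1) * cinner (snd x) g2 = cinner ((fst x \<otimes>\<^sub>t snd x) g1) g2" for g1 g2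
    by (metis simple_tensor_def cinner_commute cinner_scaleC_left)
  with Cons show ?case
    by (simp add: sum_of_tensors_def cinner_add_left case_prod_unfold sum_list_addf)
qed

lemma tensor_sum_right:
  "(\<Sum>(f1, f2)\<leftarrow>xs. \<Sum>(g1, g2)\<leftarrow>ys. cnj (cinner f1 g1) * cinner f2 g2) =
   (\<Sum>(f1, f2)\<leftarrow>xs. cinner f2 (sum_of_tensors ys f1))"
proof -
  have "(\<Sum>(g1, g2)\<leftarrow>ys. cnj (cinner f1 g1) * cinner f2 g2) = cinner f2 (sum_of_tensors ys f1)" for f1 f2
  proof (induction ys)
    case Nil
    then show ?case by (simp add: sum_of_tensors_def cinner_zero_right)
  next
    case (Cons y ys)
    then show ?case
      by (simp add: sum_of_tensors_def cinner_add_right simple_tensor_def cinner_scaleC_right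
          case_prod_unfold)
  qed
  then show ?thesis by simp
qed

lemma tensor_inner_sum_of_tensors:
  "tensor_inner (sum_of_tensors xs) (sum_of_tensors ys) =
   (\<Sum>(f1, f2)\<leftarrow>xs. \<Sum>(g1, g2)\<leftarrow>ys. cnj (cinner f1 g1) * cinner f2 g2)"
  unfolding tensor_inner_def
proof (rule the_equality)
  fix z
  assume "\<exists>xs' ys'. sum_of_tensors xs = sum_of_tensors xs' \<and> sum_of_tensors ys = sum_of_tensors ys' \<and>
    z = (\<Sum>(f1, f2)\<leftarrow>xs'. \<Sum>(g1, g2)\<leftarrow>ys'. cnj (cinner f1 g1) * cinner f2 g2)"
  then obtain xs' ys' where x: "sum_of_tensors xs = sum_of_tensors xs'"
    and y: "sum_of_tensors ys = sum_of_tensors ys'"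
    and z: "z = (\<Sum>(f1, f2)\<leftarrow>xs'. \<Sum>(g1, g2)\<leftarrow>ys'. cnj (cinner f1 g1) * cinner f2 g2)"
    by blast
  have "z = (\<Sum>(g1, g2)\<leftarrow>ys'. cinner (sum_of_tensors xs g1) g2)"
    unfolding z tensor_sum_left x ..
  also have "\<dots> = (\<Sum>(f1, f2)\<leftarrow>xs. cinner f2 (sum_of_tensors ys f1))"
    unfolding tensor_sum_left[symmetric] tensor_sum_right y ..
  finally show "z = (\<Sum>(f1, f2)\<leftarrow>xs. \<Sum>(g1, g2)\<leftarrow>ys. cnj (cinner f1 g1) * cinner f2 g2)"
    unfolding tensor_sum_right .
qed blast

section \<open>Coorbit spaces\<close>

text \<open>
  Coefficients with respect to the canonical dual of \<open>\<Psi>1 \<otimes> \<Psi>2\<close>, which is the tensor product of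
  the canonical duals: for finite-rank operators and for elements of the completed tensor product.
\<close>

definition alg_coeff ::
    "('i \<Rightarrow> 'a::complex_hilbert_space) \<Rightarrow> ('j \<Rightarrow> 'b::complex_hilbert_space) \<Rightarrow>
     ('a \<Rightarrow> 'b) \<Rightarrow> 'i \<Rightarrow> 'j \<Rightarrow> complex"
  where "alg_coeff \<Psi>1 \<Psi>2 F i j = tensor_inner F (dual_frame \<Psi>1 i \<otimes>\<^sub>t dual_frame \<Psi>2 j)"

definition tensor_coeff ::
    "('i \<Rightarrow> 'a::complex_hilbert_space) \<Rightarrow> ('j \<Rightarrow> 'b::complex_hilbert_space) \<Rightarrow>
     ('a, 'b) tensor \<Rightarrow> 'i \<Rightarrow> 'j \<Rightarrow> complex"
  where "tensor_coeff \<Psi>1 \<Psi>2 X i j =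
    hilbert_tensor_inner X (embed_tensor (dual_frame \<Psi>1 i \<otimes>\<^sub>t dual_frame \<Psi>2 j))"

definition Hinf_seqs ::
    "('i \<Rightarrow> 'a::complex_hilbert_space) \<Rightarrow> ('j \<Rightarrow> 'b::complex_hilbert_space) \<Rightarrow>
     (nat \<Rightarrow> ('a, 'b) tensor) set"
  where "Hinf_seqs \<Psi>1 \<Psi>2 = {F. (\<forall>n. F n \<in> hilbert_tensor) \<and>
    (\<forall>i j. convergent (\<lambda>n. tensor_coeff \<Psi>1 \<Psi>2 (F n) i j)) \<and>
    (\<exists>B. \<forall>n i j. cmod (tensor_coeff \<Psi>1 \<Psi>2 (F n) i j) \<le> B)}"

definition Hinf_equiv ::
    "('i \<Rightarrow> 'a::complex_hilbert_space) \<Rightarrow> ('j \<Rightarrow> 'b::complex_hilbert_space) \<Rightarrow>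
     ((nat \<Rightarrow> ('a, 'b) tensor) \<times> (nat \<Rightarrow> ('a, 'b) tensor)) set"
  where "Hinf_equiv \<Psi>1 \<Psi>2 = {(F, G). F \<in> Hinf_seqs \<Psi>1 \<Psi>2 \<and> G \<in> Hinf_seqs \<Psi>1 \<Psi>2 \<and>
    (\<forall>i j. (\<lambda>n. tensor_coeff \<Psi>1 \<Psi>2 (F n) i j - tensor_coeff \<Psi>1 \<Psi>2 (G n) i j) \<longlonglongrightarrow> 0)}"

definition Hinf ::
    "('i \<Rightarrow> 'a::complex_hilbert_space) \<Rightarrow> ('j \<Rightarrow> 'b::complex_hilbert_space) \<Rightarrow>
     (nat \<Rightarrow> ('a, 'b) tensor) set set"
  where "Hinf \<Psi>1 \<Psi>2 = Hinf_seqs \<Psi>1 \<Psi>2 // Hinf_equiv \<Psi>1 \<Psi>2"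

definition Hinf_coeff ::
    "('i \<Rightarrow> 'a::complex_hilbert_space) \<Rightarrow> ('j \<Rightarrow> 'b::complex_hilbert_space) \<Rightarrow>
     (nat \<Rightarrow> ('a, 'b) tensor) set \<Rightarrow> 'i \<Rightarrow> 'j \<Rightarrow> complex"
  where "Hinf_coeff \<Psi>1 \<Psi>2 K i j = (THE z. \<exists>F\<in>K. (\<lambda>n. tensor_coeff \<Psi>1 \<Psi>2 (F n) i j) \<longlonglongrightarrow> z)"

definition H00 ::
    "('i \<Rightarrow> 'a::complex_hilbert_space) \<Rightarrow> ('j \<Rightarrow> 'b::complex_hilbert_space) \<Rightarrow> ('a \<Rightarrow> 'b) set"
  where "H00 \<Psi>1 \<Psi>2 = cspan {\<Psi>1 i \<otimes>\<^sub>t \<Psi>2 j | i j. True}"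

text \<open>
  The completion of \<^const>\<open>H00\<close> in the norm \<open>nrm\<close> of the coefficients, regarded as a subspace of
  \<^const>\<open>Hinf\<close>: an element \<open>X\<close> of the completion, whose coefficients are the limits of those of any
  representing Cauchy sequence, is identified with the element of \<^const>\<open>Hinf\<close> with the same coefficients.
\<close>

definition coorbit_completion ::
    "(('i \<Rightarrow> 'j \<Rightarrow> complex) \<Rightarrow> ennreal) \<Rightarrow>
     ('i \<Rightarrow> 'a::complex_hilbert_space) \<Rightarrow> ('j \<Rightarrow> 'b::complex_hilbert_space) \<Rightarrow>
     (nat \<Rightarrow> ('a, 'b) tensor) set set"
  where "coorbit_completion nrm \<Psi>1 \<Psi>2 = {K \<in> Hinf \<Psi>1 \<Psi>2.
    \<exists>X\<in>completion (H00 \<Psi>1 \<Psi>2) (\<lambda>F. nrm (alg_coeff \<Psi>1 \<Psi>2 F)).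
      \<exists>F\<in>X. \<forall>i j. (\<lambda>n. alg_coeff \<Psi>1 \<Psi>2 (F n) i j) \<longlonglongrightarrow> Hinf_coeff \<Psi>1 \<Psi>2 K i j}"

definition Hpp ::
    "real \<Rightarrow> ('i \<Rightarrow> 'a::complex_hilbert_space) \<Rightarrow> ('j \<Rightarrow> 'b::complex_hilbert_space) \<Rightarrow>
     (nat \<Rightarrow> ('a, 'b) tensor) set set"
  where "Hpp p = coorbit_completion (lpp_norm p)"

definition H2p ::
    "real \<Rightarrow> ('i \<Rightarrow> 'a::complex_hilbert_space) \<Rightarrow> ('j \<Rightarrow> 'b::complex_hilbert_space) \<Rightarrow>
     (nat \<Rightarrow> ('a, 'b) tensor) set set"
  where "H2p p = coorbit_completion (l2p_norm p)"

text \<open>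
  The \<open>\<ell>\<^sup>1\<close> coorbit space of a single frame, as a subset of the Hilbert space: an element of the
  completion is identified with the Hilbert space limit of its representing Cauchy sequences.
\<close>

definition H1 :: "('i \<Rightarrow> 'a::complex_hilbert_space) \<Rightarrow> 'a set"
  where "H1 \<Psi> = {f. \<exists>X\<in>completion (cspan (range \<Psi>)) (\<lambda>f. lp_norm 1 (analysis_op (dual_frame \<Psi>) f)).
    \<exists>F\<in>X. F \<longlonglongrightarrow> f}"

section \<open>Kernels of operators\<close>

definition kernel_pairing ::
    "('i \<Rightarrow> 'a::complex_hilbert_space) \<Rightarrow> ('j \<Rightarrow> 'b::complex_hilbert_space) \<Rightarrow>
     (nat \<Rightarrow> ('a, 'b) tensor) set \<Rightarrow> ('a \<Rightarrow> 'b) \<Rightarrow> complex"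
  where "kernel_pairing \<Psi>1 \<Psi>2 K F =
    (\<Sum>\<^sub>\<infinity>(i, j). Hinf_coeff \<Psi>1 \<Psi>2 K i j * cnj (tensor_inner F (\<Psi>1 i \<otimes>\<^sub>t \<Psi>2 j)))"

definition is_kernel ::
    "('i \<Rightarrow> 'a::complex_hilbert_space) \<Rightarrow> ('j \<Rightarrow> 'b::complex_hilbert_space) \<Rightarrow>
     ('a \<Rightarrow> 'b) \<Rightarrow> (nat \<Rightarrow> ('a, 'b) tensor) set \<Rightarrow> bool"
  where "is_kernel \<Psi>1 \<Psi>2 T K \<longleftrightarrow> K \<in> Hinf \<Psi>1 \<Psi>2 \<and>
    (\<forall>f1\<in>H1 \<Psi>1. \<forall>f2\<in>H1 \<Psi>2. cinner (T f1) f2 = kernel_pairing \<Psi>1 \<Psi>2 K (f1 \<otimes>\<^sub>t f2))"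

end

theory Submission
  imports Defs
begin

text \<open>
  The kernel of \<open>T\<close> is a coefficient matrix \<open>k\<^sub>i\<^sub>j\<close> with \<open>T x = \<Sum>\<^sub>i \<langle>x, \<psi>\<^sub>1\<^sub>,\<^sub>i\<rangle> g\<^sub>i\<close>, where \<open>g\<^sub>i = \<Sum>\<^sub>j k\<^sub>i\<^sub>j \<psi>\<^sub>2\<^sub>,\<^sub>j\<close>. A frame is a Bessel
  family, so \<open>\<parallel>g\<^sub>i\<parallel>\<close> is at most a constant times the \<open>\<ell>\<^sup>2\<close> norm of the \<open>i\<close>-th row. Thus a kernel with rows in \<open>\<ell>\<^sup>2\<close>
  whose norms lie in \<open>\<ell>\<^sup>p\<close> makes \<open>T\<close> the composition of the bounded analysis operator \<open>x \<mapsto> (\<langle>x, \<psi>\<^sub>1\<^sub>,\<^sub>i\<rangle>)\<^sub>i\<close> with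
  an operator that sends the unit vectors of \<open>\<ell>\<^sup>2\<close> to vectors \<open>g\<^sub>i\<close> with \<open>\<Sum>\<^sub>i \<parallel>g\<^sub>i\<parallel>\<^sup>p < \<infinity>\<close>. For \<open>1 \<le> p \<le> 2\<close> such operators
  belong to the Schatten class (\<open>bessel_sum_in_schatten_class\<close>).

  The criterion rests on two facts. A compact operator has a singular value decomposition
  (\<open>compact_operator_canonical_decomposition\<close>), obtained by maximising \<open>\<parallel>T x\<parallel> / \<parallel>x\<parallel>\<close> over successive orthogonal
  complements. The singular values \<open>s\<^sub>n = \<langle>T e\<^sub>n, f\<^sub>n\<rangle> = \<Sum>\<^sub>i \<langle>e\<^sub>n, \<psi>\<^sub>1\<^sub>,\<^sub>i\<rangle> \<langle>g\<^sub>i, f\<^sub>n\<rangle>\<close> are then estimated by interpolating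
  between the trivial bound for \<open>p = 1\<close> and the Hilbert-Schmidt bound for \<open>p = 2\<close>
  (\<open>singular_values_powr_summable\<close>).

  The elements of the coorbit spaces are limits of finite-rank operators, and the finiteness of the mixed norm of
  their coefficients is a matter of choosing one member \<open>G\<close> of the approximating sequence: the difference of the
  coefficients of \<open>K\<close> and \<open>G\<close> is an entrywise limit of matrices from the unit ball, hence lies in it
  (\<open>coorbit_completion_near_H00\<close>, \<open>l2p_unit_ball_limit\<close>), while \<open>G\<close> itself only adds finitely many terms to the
  expansion of \<open>T\<close> (\<open>kernel_near_finite_rank_imp_schatten\<close>). For \<open>p \<le> 2\<close> the unit ball of \<open>\<ell>\<^sup>p\<^sup>,\<^sup>p\<close> is contained in that of
  \<open>\<ell>\<^sup>2\<^sup>,\<^sup>p\<close>, which reduces the second assertion to the first.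
\<close>

section \<open>Complex Hilbert spaces\<close>

lemma cinner_diff_left: "cinner (x - y) (z :: 'a::complex_hilbert_space) = cinner x z - cinner y z"
  using cinner_add_left[of "x - y" y z] by simp

lemma cinner_sum_left: "cinner (\<Sum>i\<in>F. f i) (y :: 'a::complex_hilbert_space) = (\<Sum>i\<in>F. cinner (f i) y)"
  by (induction F rule: infinite_finite_induct) (simp_all add: cinner_zero_left cinner_add_left)

lemma cinner_sum_right: "cinner y (\<Sum>i\<in>F. f i :: 'a::complex_hilbert_space) = (\<Sum>i\<in>F. cinner y (f i))"
  by (induction F rule: infinite_finite_induct) (simp_all add: cinner_zero_right cinner_add_right)

lemma norm_scaleC: "norm (c *\<^sub>C x :: 'a::complex_hilbert_space) = cmod c * norm x"
proof -
  have "complex_of_real ((norm (c *\<^sub>C x))\<^sup>2) = c * cnj c * complex_of_real ((norm x)\<^sup>2)"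
    by (metis cinner_self cinner_scaleC_left cinner_scaleC_right mult.assoc)
  also have "\<dots> = complex_of_real ((cmod c * norm x)\<^sup>2)"
    by (simp add: complex_norm_square[symmetric] power_mult_distrib flip: of_real_power)
  finally have "(norm (c *\<^sub>C x))\<^sup>2 = (cmod c * norm x)\<^sup>2"
    using of_real_eq_iff by blast
  then show ?thesis
    by simp
qed

lemma norm_add_square:
  "(norm (x + y :: 'a::complex_hilbert_space))\<^sup>2 = (norm x)\<^sup>2 + 2 * Re (cinner x y) + (norm y)\<^sup>2"
proof -
  have "complex_of_real ((norm (x + y))\<^sup>2) = cinner x x + cinner x y + cnj (cinner x y) + cinner y y"
    by (simp only: cinner_self[symmetric] cinner_add_left cinner_add_right cinner_commute[of y x])
       (simp add: algebra_simps)
  then have "Re (complex_of_real ((norm (x + y))\<^sup>2)) = Re (\<dots>)"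
    by simp
  then show ?thesis
    by (simp add: cinner_self del: of_real_power)
qed

lemma norm_diff_square:
  "(norm (x - y :: 'a::complex_hilbert_space))\<^sup>2 = (norm x)\<^sup>2 - 2 * Re (cinner x y) + (norm y)\<^sup>2"
  using norm_add_square[of "x - y" y] by (simp add: cinner_diff_left cinner_self del: of_real_power)

lemma parallelogram_law:
  "(norm (x + y))\<^sup>2 + (norm (x - y :: 'a::complex_hilbert_space))\<^sup>2 = 2 * (norm x)\<^sup>2 + 2 * (norm y)\<^sup>2"
  by (simp add: norm_add_square norm_diff_square)

lemma cinner_times_self_swap:
  "cinner x y * cinner y x = complex_of_real ((cmod (cinner x y))\<^sup>2)" for x :: "'a::complex_hilbert_space"
  by (metis cinner_commute complex_norm_square)

lemma cinner_Cauchy_Schwarz: "cmod (cinner x (y :: 'a::complex_hilbert_space)) \<le> norm x * norm y"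
proof (cases "y = 0")
  case True
  then show ?thesis by (simp add: cinner_zero_right)
next
  case False
  define c where "c = cinner x y / complex_of_real ((norm y)\<^sup>2)"
  have "cinner x (c *\<^sub>C y) = complex_of_real ((cmod (cinner x y))\<^sup>2 / (norm y)\<^sup>2)"
    by (simp add: c_def cinner_scaleC_right complex_norm_square del: of_real_power)
  moreover have "(norm (c *\<^sub>C y))\<^sup>2 = (cmod (cinner x y))\<^sup>2 / (norm y)\<^sup>2"
    using False by (simp add: norm_scaleC c_def norm_divide power_divide power_mult_distrib field_simps
        norm_power flip: of_real_power)
  ultimately have "(norm (x - c *\<^sub>C y))\<^sup>2 = (norm x)\<^sup>2 - (cmod (cinner x y))\<^sup>2 / (norm y)\<^sup>2"
    by (simp add: norm_diff_square)
  then have "(cmod (cinner x y))\<^sup>2 / (norm y)\<^sup>2 \<le> (norm x)\<^sup>2"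
    by (smt (verit) zero_le_power2)
  then have "(cmod (cinner x y))\<^sup>2 \<le> (norm x * norm y)\<^sup>2"
    using False by (simp add: field_simps power_mult_distrib)
  then show ?thesis
    by (rule power2_le_imp_le) simp
qed

lemma bounded_linear_cinner_left: "bounded_linear (\<lambda>x. cinner x (y :: 'a::complex_hilbert_space))"
proof (rule bounded_linear_intro[where K = "norm y"])
  show "cinner (r *\<^sub>R x) y = r *\<^sub>R cinner x y" for r x
    by (simp add: scaleR_scaleC cinner_scaleC_left scaleC_complex_def)
qed (simp_all add: cinner_add_left cinner_Cauchy_Schwarz)

lemma bounded_linear_scaleC_left: "bounded_linear (\<lambda>c. c *\<^sub>C (x :: 'a::complex_hilbert_space))"
  by (rule bounded_linear_intro[where K = "norm x"])
     (simp_all add: scaleC_add_left norm_scaleC scaleR_scaleC scaleC_scaleC scaleC_complex_def)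

lemma bounded_linear_scaleC_right: "bounded_linear (\<lambda>x. c *\<^sub>C (x :: 'a::complex_hilbert_space))"
  by (rule bounded_linear_intro[where K = "cmod c"])
     (simp_all add: scaleC_add_right norm_scaleC scaleR_scaleC scaleC_scaleC mult.commute)

lemma bounded_clinear_scaleC: "bounded_clinear T \<Longrightarrow> T (c *\<^sub>C x) = c *\<^sub>C T x"
  by (simp add: bounded_clinear_def)

lemma bounded_clinear_linear: "bounded_clinear T \<Longrightarrow> linear T"
  by (simp add: bounded_clinear_def bounded_linear.linear)

lemma norm_square_eq_Re_cinner: "(norm x)\<^sup>2 = Re (cinner x (x :: 'a::complex_hilbert_space))"
  by (simp add: cinner_self del: of_real_power)

lemma cinner_orthonormal_expansion:
  fixes e :: "nat \<Rightarrow> 'a::complex_hilbert_space"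
  assumes "orthonormal_on N e" "finite F" "F \<subseteq> N" "n \<in> N"
  shows "cinner (\<Sum>m\<in>F. c m *\<^sub>C e m) (e n) = (if n \<in> F then c n else 0)"
proof -
  have "cinner (\<Sum>m\<in>F. c m *\<^sub>C e m) (e n) = (\<Sum>m\<in>F. if n = m then c m else 0)"
    unfolding cinner_sum_left cinner_scaleC_left
    using assms by (intro sum.cong) (auto simp: orthonormal_on_def)
  then show ?thesis
    using assms(2) by (simp add: sum.delta)
qed

text \<open>
  Bessel's inequality comes with the projection: subtracting from \<open>x\<close> its expansion in finitely
  many orthonormal vectors leaves a vector that is orthogonal to them, and Pythagoras gives its length.
\<close>

lemma orthonormal_residual:
  fixes e :: "nat \<Rightarrow> 'a::complex_hilbert_space"
  assumes "orthonormal_on N e" "finite F" "F \<subseteq> N"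
  defines "r \<equiv> \<lambda>x. x - (\<Sum>m\<in>F. cinner x (e m) *\<^sub>C e m)"
  shows orthonormal_residual_orthogonal: "n \<in> F \<Longrightarrow> cinner (r x) (e n) = 0"
    and norm_orthonormal_residual: "(norm (r x))\<^sup>2 = (norm x)\<^sup>2 - (\<Sum>m\<in>F. (cmod (cinner x (e m)))\<^sup>2)"
proof -
  show orth: "cinner (r x) (e n) = 0" if "n \<in> F" for n x
    using cinner_orthonormal_expansion[OF assms(1-3), of n] that assms(3)
    by (auto simp: r_def cinner_diff_left)
  define P where "P = (\<Sum>m\<in>F. cinner x (e m) *\<^sub>C e m)"
  have "cinner (r x) P = 0"
    unfolding P_def cinner_sum_right cinner_scaleC_right using orth by simp
  then have "(norm (r x + P))\<^sup>2 = (norm (r x))\<^sup>2 + (norm P)\<^sup>2"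
    by (simp add: norm_add_square)
  moreover have "cinner P P = (\<Sum>m\<in>F. cnj (cinner x (e m)) * cinner P (e m))"
    unfolding P_def cinner_sum_right cinner_scaleC_right ..
  moreover have "\<dots> = (\<Sum>m\<in>F. complex_of_real ((cmod (cinner x (e m)))\<^sup>2))"
    using cinner_orthonormal_expansion[OF assms(1-3)] assms(3)
    by (intro sum.cong) (auto simp: P_def complex_norm_square mult.commute simp del: of_real_power)
  ultimately show "(norm (r x))\<^sup>2 = (norm x)\<^sup>2 - (\<Sum>m\<in>F. (cmod (cinner x (e m)))\<^sup>2)"
    by (simp add: r_def P_def[symmetric] norm_square_eq_Re_cinner del: of_real_power)
qed

lemma Bessel_inequality:
  fixes e :: "nat \<Rightarrow> 'a::complex_hilbert_space"
  assumes "orthonormal_on N e" "finite F" "F \<subseteq> N"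
  shows "(\<Sum>m\<in>F. (cmod (cinner x (e m)))\<^sup>2) \<le> (norm x)\<^sup>2"
  using norm_orthonormal_residual[OF assms, of x] by (smt (verit) zero_le_power2)

section \<open>Unconditional sums\<close>

text \<open>
  Synthesis series converge unconditionally but in general not absolutely, so their summability has to come from the
  completeness of the space.
\<close>

lemma summable_on_CauchyI:
  fixes f :: "'k \<Rightarrow> 'a::banach"
  assumes "\<And>\<epsilon>. \<epsilon> > 0 \<Longrightarrow> \<exists>F. finite F \<and> F \<subseteq> I \<and> (\<forall>G. finite G \<longrightarrow> G \<subseteq> I - F \<longrightarrow> norm (sum f G) \<le> \<epsilon>)"
  shows "f summable_on I"
proof -
  have "\<exists>P. eventually P (finite_subsets_at_top I) \<and>
          (\<forall>F F'. P F \<and> P F' \<longrightarrow> dist (sum f F) (sum f F') < e)" if "e > 0" for e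
  proof -
    obtain F where F: "finite F" "F \<subseteq> I"
      and small: "\<And>G. finite G \<Longrightarrow> G \<subseteq> I - F \<Longrightarrow> norm (sum f G) \<le> e / 3"
      using assms[of "e / 3"] \<open>e > 0\<close> by auto
    define P where "P G \<longleftrightarrow> finite G \<and> F \<subseteq> G \<and> G \<subseteq> I" for G
    have "eventually P (finite_subsets_at_top I)"
      unfolding P_def eventually_finite_subsets_at_top using F by blast
    moreover have "dist (sum f G) (sum f F) \<le> e / 3" if "P G" for G
    proof -
      have "sum f G - sum f F = sum f (G - F)"
        using that by (subst sum_diff) (auto simp: P_def)
      then show ?thesis
        unfolding dist_norm using small[of "G - F"] that by (auto simp: P_def)
    qed
    note near = this
    have "dist (sum f G) (sum f G') < e" if "P G" "P G'" for G G'
      using dist_triangle2[of "sum f G" "sum f G'" "sum f F"] near[OF that(1)] near[OF that(2)] \<open>e > 0\<close>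
      by linarith
    ultimately show ?thesis by blast
  qed
  then have "cauchy_filter (filtermap (sum f) (finite_subsets_at_top I))"
    by (simp add: cauchy_filter_metric_filtermap)
  moreover have "complete (UNIV :: 'a set)"
    by (meson Cauchy_convergent UNIV_I complete_def convergent_def)
  ultimately obtain L where "(sum f \<longlongrightarrow> L) (finite_subsets_at_top I)"
    using complete_uniform[where S = UNIV] by (force simp add: filterlim_def)
  then show ?thesis
    using summable_on_def has_sum_def by blast
qed

lemma nonneg_summable_on_boundedI:
  fixes f :: "'k \<Rightarrow> real"
  assumes "\<And>i. i \<in> I \<Longrightarrow> 0 \<le> f i" and "\<And>F. finite F \<Longrightarrow> F \<subseteq> I \<Longrightarrow> sum f F \<le> M"
  shows "f summable_on I" and "infsum f I \<le> M"
proof -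
  show "f summable_on I"
    by (rule nonneg_bdd_above_summable_on) (auto intro!: bdd_aboveI2 assms)
  then show "infsum f I \<le> M"
    by (rule infsum_le_finite_sums) (use assms in auto)
qed

lemma nonneg_summable_on_tail:
  fixes f :: "'k \<Rightarrow> real"
  assumes "f summable_on I" and "\<And>i. i \<in> I \<Longrightarrow> 0 \<le> f i" and "\<epsilon> > 0"
  obtains F where "finite F" "F \<subseteq> I" "\<And>G. finite G \<Longrightarrow> G \<subseteq> I - F \<Longrightarrow> sum f G \<le> \<epsilon>"
proof -
  obtain F where F: "finite F" "F \<subseteq> I" "dist (sum f F) (infsum f I) \<le> \<epsilon>"
    using has_sum_finite_approximation[OF has_sum_infsum[OF assms(1)] assms(3)] by blast
  have "sum f G \<le> \<epsilon>" if G: "finite G" "G \<subseteq> I - F" for G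
  proof -
    have "sum f (F \<union> G) \<le> infsum f I"
      using F G assms by (intro finite_sum_le_infsum) auto
    moreover have "sum f (F \<union> G) = sum f F + sum f G"
      using F G by (intro sum.union_disjoint) auto
    ultimately show ?thesis
      using F(3) by (simp add: dist_real_def)
  qed
  with F that show thesis by blast
qed

lemma has_sum_norm_bound:
  fixes f :: "'k \<Rightarrow> 'a::real_normed_vector"
  assumes "(f has_sum S) I" and "\<And>F. finite F \<Longrightarrow> F \<subseteq> I \<Longrightarrow> norm (sum f F) \<le> M"
  shows "norm S \<le> M"
proof (rule tendsto_upperbound)
  show "((\<lambda>F. norm (sum f F)) \<longlongrightarrow> norm S) (finite_subsets_at_top I)"
    using assms(1) unfolding has_sum_def by (rule tendsto_norm)
  show "\<forall>\<^sub>F F in finite_subsets_at_top I. norm (sum f F) \<le> M"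
    by (rule eventually_finite_subsets_at_top_weakI) (rule assms(2))
qed simp

text \<open>Partial sums approximate as well as the finite sums outside of them are small.\<close>

lemma has_sum_remainder_bound:
  fixes f :: "'k \<Rightarrow> 'a::real_normed_vector"
  assumes "(f has_sum S) I" "finite F" "F \<subseteq> I"
    and "\<And>G. finite G \<Longrightarrow> G \<subseteq> I - F \<Longrightarrow> norm (sum f G) \<le> M"
  shows "norm (S - sum f F) \<le> M"
proof -
  have "(f has_sum (S - sum f F)) (I - F)"
    using assms(1-3) by (intro has_sum_Diff) (auto simp: has_sum_finite)
  then show ?thesis
    using assms(4) by (rule has_sum_norm_bound)
qed

lemma sum_mult_le_sqrt:
  fixes a b :: "'k \<Rightarrow> real"
  assumes "(\<Sum>i\<in>F. (a i)\<^sup>2) \<le> A" "(\<Sum>i\<in>F. (b i)\<^sup>2) \<le> B"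
  shows "(\<Sum>i\<in>F. a i * b i) \<le> sqrt A * sqrt B"
proof -
  have "(\<Sum>i\<in>F. a i * b i)\<^sup>2 \<le> (\<Sum>i\<in>F. (a i)\<^sup>2) * (\<Sum>i\<in>F. (b i)\<^sup>2)"
    by (rule Cauchy_Schwarz_ineq_sum)
  also have "\<dots> \<le> A * B"
    using assms by (intro mult_mono) (auto intro: sum_nonneg order_trans[OF sum_nonneg assms(1)])
  finally show ?thesis
    using real_le_rsqrt by (simp flip: real_sqrt_mult)
qed

section \<open>Singular value decomposition of compact operators\<close>

lemma compact_operator_convergent_subsequence:
  fixes x :: "nat \<Rightarrow> 'a::complex_hilbert_space"
  assumes "compact_operator T" and "\<And>n. norm (x n) \<le> 1"
  obtains r y where "strict_mono r" "(\<lambda>n. T (x (r n))) \<longlonglongrightarrow> y"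
proof -
  have sc: "seq_compact (closure (T ` cball 0 1))"
    using assms(1) by (simp add: compact_operator_def compact_imp_seq_compact)
  have "\<And>n. T (x n) \<in> closure (T ` cball 0 1)"
    using assms(2) closure_subset by fastforce
  then obtain y r where "strict_mono r" "((\<lambda>n. T (x n)) \<circ> r) \<longlonglongrightarrow> y"
    using seq_compactE[OF sc, of "\<lambda>n. T (x n)"] by blast
  then show thesis
    by (intro that) (simp_all add: o_def)
qed

text \<open>
  Norm convergence of a maximising sequence comes from the parallelogram law. Let \<open>x\<^sub>n\<close> be vectors in \<open>V\<close> of length at most
  \<open>1\<close> for which \<open>T x\<^sub>n\<close> converges to a vector whose length is the norm \<open>s\<close> of \<open>T\<close> on \<open>V\<close>. Then \<open>T (x\<^sub>n + x\<^sub>m)\<close> has nearly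
  length \<open>2 s\<close>, so \<open>x\<^sub>n + x\<^sub>m\<close> has nearly length \<open>2\<close>, and the parallelogram law forces \<open>x\<^sub>n - x\<^sub>m\<close>
  to be short: the \<open>x\<^sub>n\<close> converge themselves, without recourse to weak compactness or to an adjoint.
\<close>

lemma compact_operator_attains_norm:
  fixes T :: "'a::complex_hilbert_space \<Rightarrow> 'b::complex_hilbert_space"
  assumes T: "compact_operator T" and V: "csubspace V" "closed V"
  obtains e where "e \<in> V" "\<And>x. x \<in> V \<Longrightarrow> norm (T x) \<le> norm (T e) * norm x"
    "e = 0 \<or> norm e = 1 \<and> T e \<noteq> 0"
proof (cases "\<forall>x\<in>V. T x = 0")
  case True
  then show thesis
    using that[of 0] complex_vector.subspace_0[OF V(1)] by simp
next
  case False
  have bT: "bounded_linear T" and lT: "linear T"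
    using T by (auto simp: compact_operator_def bounded_clinear_def bounded_linear.linear)
  obtain b where b: "b > 0" "\<And>x. norm (T x) \<le> b * norm x"
    using bounded_linear.pos_bounded[OF bT] by (metis mult.commute)
  define S where "S = {norm (T x) | x. x \<in> V \<and> norm x \<le> 1}"
  define s where "s = Sup S"
  have bdd: "bdd_above S"
  proof (rule bdd_aboveI)
    fix v assume "v \<in> S"
    then obtain x where x: "v = norm (T x)" "norm x \<le> 1"
      by (auto simp: S_def)
    show "v \<le> b"
      using order_trans[OF b(2)[of x] mult_left_le[OF x(2), of b]] b(1) x(1) by linarith
  qed
  have le_s: "norm (T x) \<le> s * norm x" if "x \<in> V" for x
  proof (cases "x = 0")
    case True
    then show ?thesis by (simp add: linear_0[OF lT])
  next
    case x: False
    define x' where "x' = (1 / norm x) *\<^sub>R x"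
    have "x' \<in> V" "norm x' = 1"
      using x that complex_vector.subspace_scale[OF V(1)] by (simp_all add: x'_def scaleR_scaleC norm_scaleC norm_divide)
    then have "norm (T x') \<le> s"
      unfolding s_def by (intro cSup_upper bdd) (auto simp: S_def)
    then show ?thesis
      using x by (simp add: x'_def linear_cmul[OF lT] field_simps)
  qed
  obtain x0 where x0: "x0 \<in> V" "T x0 \<noteq> 0"
    using False by auto
  have "s > 0"
    using le_s[OF x0(1)] x0(2)
    by (metis linorder_not_less mult_nonpos_nonneg norm_ge_zero norm_le_zero_iff order_trans)
  have "\<exists>x. x \<in> V \<and> norm x \<le> 1 \<and> norm (T x) > s - 1 / real (Suc n)" for n
  proof -
    have "S \<noteq> {}"
      using complex_vector.subspace_0[OF V(1)] unfolding S_def by force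
    then have "\<exists>v\<in>S. s - 1 / real (Suc n) < v"
      by (subst less_cSup_iff[OF _ bdd, symmetric]) (auto simp: s_def)
    then show ?thesis by (auto simp: S_def)
  qed
  then obtain x where x: "\<And>n. x n \<in> V" "\<And>n. norm (x n) \<le> 1" "\<And>n. norm (T (x n)) > s - 1 / real (Suc n)"
    by metis
  obtain r y where r: "strict_mono r" and y: "(\<lambda>n. T (x (r n))) \<longlonglongrightarrow> y"
    by (rule compact_operator_convergent_subsequence[OF T x(2)])
  have "norm y = s"
  proof (rule antisym)
    have "norm (T (x n)) \<le> s" for n
      using le_s[OF x(1)] x(2)[of n] \<open>s > 0\<close> by (meson mult_left_le less_imp_le order_trans)
    then show "norm y \<le> s"
      using tendsto_norm[OF y] by (intro LIMSEQ_le_const2) auto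
    have "(\<lambda>n. s - 1 / real (Suc n)) \<longlonglongrightarrow> s - 0"
      by (intro tendsto_diff tendsto_const LIMSEQ_Suc[OF lim_1_over_n])
    from LIMSEQ_subseq_LIMSEQ[OF this r]
    have "(\<lambda>n. s - 1 / real (Suc (r n))) \<longlonglongrightarrow> s"
      by (simp add: o_def)
    moreover have "\<forall>n\<ge>0. s - 1 / real (Suc (r n)) \<le> norm (T (x (r n)))"
      using x(3) by (meson less_imp_le)
    ultimately show "s \<le> norm y"
      using LIMSEQ_le[OF _ tendsto_norm[OF y]] by blast
  qed
  have "Cauchy (\<lambda>n. x (r n))"
  proof (rule metric_CauchyI)
    fix \<epsilon> :: real assume "\<epsilon> > 0"
    (* If T (x n) and T (x m) are within \<delta> of their limit, then x n + x m is at least 2 - 2 \<delta> / s long,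
       and the parallelogram law bounds the squared distance of x n and x m by 8 \<delta> / s. *)
    define \<delta> where "\<delta> = min s (s * \<epsilon>\<^sup>2 / 16)"
    have \<delta>: "\<delta> > 0" "\<delta> \<le> s" "16 * \<delta> \<le> s * \<epsilon>\<^sup>2"
      using \<open>s > 0\<close> \<open>\<epsilon> > 0\<close> by (auto simp: \<delta>_def min_def)
    obtain M where M: "\<And>n. n \<ge> M \<Longrightarrow> norm (T (x (r n)) - y) < \<delta>"
      using y \<delta>(1) unfolding LIMSEQ_iff by blast
    have "dist (x (r m)) (x (r n)) < \<epsilon>" if "m \<ge> M" "n \<ge> M" for m n
    proof -
      define a b where "a = x (r m)" and "b = x (r n)"
      have ab: "a \<in> V" "b \<in> V" "(norm a)\<^sup>2 \<le> 1" "(norm b)\<^sup>2 \<le> 1"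
        using x by (auto simp: a_def b_def power_le_one)
      have "2 * s - 2 * \<delta> \<le> norm (T a + T b)"
        using M[OF that(1)] M[OF that(2)] \<open>norm y = s\<close>
          norm_triangle_ineq4[of "T a + T b" "(T a - y) + (T b - y)"] norm_triangle_ineq[of "T a - y" "T b - y"]
          norm_scaleR[of 2 y]
        by (simp add: a_def b_def algebra_simps scaleR_2)
      also have "\<dots> \<le> s * norm (a + b)"
        using le_s[of "a + b"] ab complex_vector.subspace_add[OF V(1)] by (simp add: linear_add[OF lT])
      finally have "2 - 2 * (\<delta> / s) \<le> norm (a + b)"
        using \<open>s > 0\<close> by (simp add: field_simps)
      moreover have "\<delta> / s \<le> 1" "\<delta> / s > 0" and \<delta>s: "16 * (\<delta> / s) \<le> \<epsilon>\<^sup>2"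
        using \<delta> \<open>s > 0\<close> by (auto simp: field_simps)
      ultimately have "(2 - 2 * (\<delta> / s))\<^sup>2 \<le> (norm (a + b))\<^sup>2"
        by (intro power_mono) auto
      moreover have "(norm (a - b))\<^sup>2 \<le> 4 - (norm (a + b))\<^sup>2"
        using parallelogram_law[of a b] ab by linarith
      moreover have "(2 - 2 * (\<delta> / s))\<^sup>2 = 4 - 8 * (\<delta> / s) + 4 * (\<delta> / s)\<^sup>2"
        by (simp add: power2_eq_square algebra_simps)
      moreover have "0 \<le> (\<delta> / s)\<^sup>2" by simp
      ultimately have "(norm (a - b))\<^sup>2 < \<epsilon>\<^sup>2"
        using \<delta>s \<open>\<delta> / s > 0\<close> by linarith
      then show ?thesis
        using \<open>\<epsilon> > 0\<close> by (simp add: a_def b_def dist_norm power2_less_imp_less)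
    qed
    then show "\<exists>M. \<forall>m\<ge>M. \<forall>n\<ge>M. dist (x (r m)) (x (r n)) < \<epsilon>" by blast
  qed
  then obtain e where e: "(\<lambda>n. x (r n)) \<longlonglongrightarrow> e"
    using Cauchy_convergent convergent_def by blast
  have "e \<in> V"
    using closed_sequentially[OF V(2) _ e] x(1) by blast
  have "norm e \<le> 1"
    using tendsto_norm[OF e] x(2) by (intro LIMSEQ_le_const2) auto
  have "T e = y"
    using bounded_linear.tendsto[OF bT e] y LIMSEQ_unique by blast
  then have Te: "norm (T e) = s"
    using \<open>norm y = s\<close> by simp
  have "norm e = 1"
    using le_s[OF \<open>e \<in> V\<close>] Te \<open>s > 0\<close> \<open>norm e \<le> 1\<close> by (simp add: field_simps)
  show thesis
  proof (rule that[OF \<open>e \<in> V\<close>])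
    show "norm (T z) \<le> norm (T e) * norm z" if "z \<in> V" for z
      using le_s[OF that] Te by simp
    show "e = 0 \<or> norm e = 1 \<and> T e \<noteq> 0"
      using \<open>norm e = 1\<close> Te \<open>s > 0\<close> by auto
  qed
qed

text \<open>
  First-order optimality: moving the maximiser \<open>e\<close> a little in a direction \<open>z\<close> orthogonal to it changes its
  length only to second order, so \<open>\<langle>T z, T e\<rangle> \<noteq> 0\<close> would allow a larger value of the quotient.
\<close>

lemma maximiser_image_orthogonal:
  fixes T :: "'a::complex_hilbert_space \<Rightarrow> 'b::complex_hilbert_space"
  assumes T: "bounded_clinear T" and V: "csubspace V" "e \<in> V" "z \<in> V"
    and e: "norm e = 1" and max: "\<And>x. x \<in> V \<Longrightarrow> norm (T x) \<le> norm (T e) * norm x"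
    and orth: "cinner z e = 0"
  shows "cinner (T z) (T e) = 0"
proof (rule ccontr)
  define w where "w = cinner (T z) (T e)"
  define s where "s = (norm (T e))\<^sup>2"
  define q where "q = s * (norm z)\<^sup>2"
  (* The phase of c makes the first-order term positive; its size t keeps the second-order term smaller. *)
  define t where "t = 1 / (1 + q)"
  define c where "c = complex_of_real t * cnj w"
  assume "cinner (T z) (T e) \<noteq> 0"
  then have w: "(cmod w)\<^sup>2 > 0"
    by (simp add: w_def)
  have "q \<ge> 0" by (simp add: q_def s_def)
  then have t: "t > 0" "t * q < 1"
    by (auto simp: t_def divide_simps)
  have c2: "(cmod c)\<^sup>2 = t\<^sup>2 * (cmod w)\<^sup>2"
    by (simp add: c_def norm_mult power_mult_distrib)
  have "cinner (T (c *\<^sub>C z)) (T e) = c * w"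
    by (simp add: w_def bounded_clinear_scaleC[OF T] cinner_scaleC_left)
  also have "\<dots> = complex_of_real (t * (cmod w)\<^sup>2)"
    by (simp only: c_def complex_norm_square of_real_mult) simp
  finally have "(norm (T (c *\<^sub>C z + e)))\<^sup>2 = (cmod c)\<^sup>2 * (norm (T z))\<^sup>2 + 2 * (t * (cmod w)\<^sup>2) + s"
    by (simp add: linear_add[OF bounded_clinear_linear[OF T]] norm_add_square bounded_clinear_scaleC[OF T]
        norm_scaleC power_mult_distrib s_def)
  moreover have "(norm (c *\<^sub>C z + e))\<^sup>2 = (cmod c)\<^sup>2 * (norm z)\<^sup>2 + 1"
    by (simp add: norm_add_square cinner_scaleC_left orth e norm_scaleC power_mult_distrib)
  moreover have "norm (T (c *\<^sub>C z + e)) \<le> norm (T e) * norm (c *\<^sub>C z + e)"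
    using V by (intro max complex_vector.subspace_add complex_vector.subspace_scale)
  then have "(norm (T (c *\<^sub>C z + e)))\<^sup>2 \<le> s * (norm (c *\<^sub>C z + e))\<^sup>2"
    unfolding s_def power_mult_distrib[symmetric] by (intro power_mono) auto
  ultimately have "(cmod c)\<^sup>2 * (norm (T z))\<^sup>2 + 2 * (t * (cmod w)\<^sup>2) \<le> s * ((cmod c)\<^sup>2 * (norm z)\<^sup>2)"
    by (simp add: algebra_simps)
  moreover have "s * ((cmod c)\<^sup>2 * (norm z)\<^sup>2) = (t * (cmod w)\<^sup>2) * (t * q)"
    unfolding c2 q_def by algebra
  moreover have "0 \<le> (cmod c)\<^sup>2 * (norm (T z))\<^sup>2" by simp
  moreover have "(t * (cmod w)\<^sup>2) * (t * q) \<le> t * (cmod w)\<^sup>2"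
    using t w by (intro mult_left_le) auto
  moreover have "t * (cmod w)\<^sup>2 > 0"
    using t w by simp
  ultimately show False by linarith
qed

text \<open>
  The vectors \<open>e\<^sub>n\<close> are chosen greedily: \<open>e\<^sub>n\<close> maximises \<open>\<parallel>T x\<parallel> / \<parallel>x\<parallel>\<close> over the orthogonal complement of its
  predecessors, and \<open>e\<^sub>n = 0\<close> if \<open>T\<close> vanishes there. The singular values \<open>\<parallel>T e\<^sub>n\<parallel>\<close> decrease, and
  they tend to \<open>0\<close> because the orthogonal vectors \<open>T e\<^sub>n\<close> have a convergent subsequence. On the orthogonal complement
  of \<open>e\<^sub>0, \<dots>, e\<^bsub>k-1\<^esub>\<close> the operator has norm \<open>\<parallel>T e\<^sub>k\<parallel>\<close>, which bounds the remainder of the expansion.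
\<close>

theorem compact_operator_canonical_decomposition:
  fixes T :: "'a::complex_hilbert_space \<Rightarrow> 'b::complex_hilbert_space"
  assumes T: "compact_operator T"
  obtains N s e f where "canonical_decomposition T N s e f"
proof -
  have bcT: "bounded_clinear T" and bT: "bounded_linear T" and lT: "linear T"
    using T by (auto simp: compact_operator_def bounded_clinear_def bounded_linear.linear)
  define V where "V e n = {x::'a. \<forall>m<n. cinner x (e m) = 0}" for e and n :: nat
  have subV: "csubspace (V e n)" for e n
    by (auto simp: V_def complex_vector.subspace_def cinner_zero_left cinner_add_left cinner_scaleC_left)
  have clV: "closed (V e n)" for e n
  proof -
    have "V e n = (\<Inter>m\<in>{..<n}. {x. cinner x (e m) = 0})"
      by (auto simp: V_def)
    moreover have "closed {x. cinner x (e m) = 0}" for m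
      by (rule closed_Collect_eq[OF linear_continuous_on[OF bounded_linear_cinner_left] continuous_on_const])
    ultimately show ?thesis
      by (simp add: closed_INT)
  qed
  define P where "P e n v \<longleftrightarrow> v \<in> V e n \<and> (\<forall>x\<in>V e n. norm (T x) \<le> norm (T v) * norm x) \<and>
    (v = 0 \<or> norm v = 1 \<and> T v \<noteq> 0)" for e n and v :: 'a
  have "\<exists>e. \<forall>n. P e n (e n)"
  proof (rule dependent_wellorder_choice)
    show "P e n v = P e' n v" if "\<And>y. y < n \<Longrightarrow> e y = e' y" for v e e' n
      using that by (simp add: P_def V_def)
    show "\<exists>v. P e n v" for n e
      using compact_operator_attains_norm[OF T subV clV, of e n] unfolding P_def by metis
  qed
  then obtain e where e: "\<And>n. P e n (e n)" by blast
  have e_V: "e n \<in> V e n" and e_max: "x \<in> V e n \<Longrightarrow> norm (T x) \<le> norm (T (e n)) * norm x"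
    and e_unit: "e n = 0 \<or> norm (e n) = 1 \<and> T (e n) \<noteq> 0" for n x
    using e[of n] unfolding P_def by blast+
  define s where "s n = norm (T (e n))" for n
  define N where "N = {n. s n > 0}"
  define f where "f n = (1 / complex_of_real (s n)) *\<^sub>C T (e n)" for n
  have bound: "norm (T x) \<le> s n * norm x" if "x \<in> V e n" for x n
    unfolding s_def using that by (rule e_max)
  have N: "n \<in> N \<longleftrightarrow> e n \<noteq> 0" and norm_e: "n \<in> N \<Longrightarrow> norm (e n) = 1" for n
    using e_unit[of n] by (auto simp: N_def s_def linear_0[OF lT])
  have norm_e_le: "norm (e n) \<le> 1" for n
    using e_unit[of n] by auto
  have orth: "cinner (e n) (e m) = 0" if "m < n" for m n
    using e_V[of n] that by (simp add: V_def)
  have Torth: "cinner (T (e n)) (T (e m)) = 0" if "m < n" for m n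
  proof (cases "m \<in> N")
    case True
    show ?thesis
    proof (rule maximiser_image_orthogonal[OF bcT subV[of e m]])
      show "e n \<in> V e m"
        using e_V[of n] that by (simp add: V_def)
    qed (use e_V e_max orth[OF that] norm_e[OF True] in blast)+
  next
    case False
    then show ?thesis
      using N by (simp add: linear_0[OF lT] cinner_zero_right)
  qed
  have decreasing: "s n \<le> s m" if "m < n" for m n
  proof -
    have "e n \<in> V e m"
      using e_V[of n] that by (simp add: V_def)
    from bound[OF this] show ?thesis
      using mult_left_le[OF norm_e_le[of n], of "s m"] by (simp add: s_def)
  qed
  have on_e: "orthonormal_on N e"
    unfolding orthonormal_on_def
  proof (intro ballI)
    fix m n assume "m \<in> N" "n \<in> N"
    then show "cinner (e m) (e n) = of_bool (m = n)"
      using orth[of m n] orth[of n m] norm_e cinner_commute[of "e m" "e n"]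
      by (cases m n rule: linorder_cases) (auto simp: cinner_self)
  qed
  have "orthonormal_on N f"
    unfolding orthonormal_on_def
  proof (intro ballI)
    fix m n assume mn: "m \<in> N" "n \<in> N"
    have eq: "cinner (f m) (f n) = cinner (T (e m)) (T (e n)) / (s m * s n)"
      by (simp add: f_def cinner_scaleC_left cinner_scaleC_right)
    show "cinner (f m) (f n) = of_bool (m = n)"
    proof (cases m n rule: linorder_cases)
      case equal
      then show ?thesis
        using mn unfolding eq by (simp add: cinner_self s_def N_def power2_eq_square)
    next
      case less
      then show ?thesis
        using Torth[OF less] cinner_commute[of "T (e m)" "T (e n)"] unfolding eq by simp
    next
      case greater
      then show ?thesis
        using Torth[OF greater] unfolding eq by simp
    qed
  qed
  have small: "\<exists>k. s k < c" if "c > 0" for c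
  proof (rule ccontr)
    assume "\<not> ?thesis"
    then have ge: "s k \<ge> c" for k by (simp add: not_less)
    obtain r y where r: "strict_mono r" and "(\<lambda>n. T (e (r n))) \<longlonglongrightarrow> y"
      by (rule compact_operator_convergent_subsequence[OF T norm_e_le])
    then have "Cauchy (\<lambda>n. T (e (r n)))"
      using LIMSEQ_imp_Cauchy by blast
    then obtain M where M: "\<And>m n. m \<ge> M \<Longrightarrow> n \<ge> M \<Longrightarrow> norm (T (e (r m)) - T (e (r n))) < c"
      using Cauchy_iff \<open>c > 0\<close> by metis
    have "r M < r (Suc M)"
      using r by (simp add: strict_mono_Suc_iff)
    then have "(norm (T (e (r (Suc M))) - T (e (r M))))\<^sup>2 = (s (r (Suc M)))\<^sup>2 + (s (r M))\<^sup>2"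
      unfolding norm_diff_square by (simp add: Torth s_def)
    moreover have "c\<^sup>2 \<le> (s (r (Suc M)))\<^sup>2"
      using ge \<open>c > 0\<close> by (intro power_mono) auto
    moreover have "(norm (T (e (r (Suc M))) - T (e (r M))))\<^sup>2 < c\<^sup>2"
      using M[of "Suc M" M] by (intro power_strict_mono) auto
    ultimately show False
      using zero_le_power2[of "s (r M)"] by linarith
  qed
  have expansion: "((\<lambda>n. (complex_of_real (s n) * cinner x (e n)) *\<^sub>C f n) has_sum T x) N" for x
    unfolding has_sum_def tendsto_iff eventually_finite_subsets_at_top
  proof (intro allI impI)
    fix \<epsilon> :: real assume "\<epsilon> > 0"
    obtain k where k: "s k < \<epsilon> / (norm x + 1)"
      using small[of "\<epsilon> / (norm x + 1)"] \<open>\<epsilon> > 0\<close>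
      by (metis add_nonneg_pos divide_pos_pos norm_ge_zero zero_less_one)
    have "dist (\<Sum>n\<in>F. (complex_of_real (s n) * cinner x (e n)) *\<^sub>C f n) (T x) < \<epsilon>"
      if F: "finite F" "{n\<in>N. n < k} \<subseteq> F" "F \<subseteq> N" for F
    proof -
      define z where "z = x - (\<Sum>n\<in>F. cinner x (e n) *\<^sub>C e n)"
      have "(complex_of_real (s n) * cinner x (e n)) *\<^sub>C f n = T (cinner x (e n) *\<^sub>C e n)" if "n \<in> F" for n
        using that F(3) by (auto simp: f_def N_def scaleC_scaleC bounded_clinear_scaleC[OF bcT])
      then have "T x - (\<Sum>n\<in>F. (complex_of_real (s n) * cinner x (e n)) *\<^sub>C f n) = T z"
        by (simp add: z_def linear_diff[OF lT] linear_sum[OF lT])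
      moreover have "z \<in> V e k"
      proof -
        have "cinner z (e m) = 0" if "m < k" for m
        proof (cases "m \<in> N")
          case True
          then show ?thesis
            unfolding z_def using F that by (intro orthonormal_residual_orthogonal[OF on_e F(1,3)]) auto
        next
          case False
          then show ?thesis by (simp add: N cinner_zero_right)
        qed
        then show ?thesis by (simp add: V_def)
      qed
      then have "norm (T z) \<le> s k * norm z"
        by (rule bound)
      moreover have "(norm z)\<^sup>2 \<le> (norm x)\<^sup>2"
        unfolding z_def norm_orthonormal_residual[OF on_e F(1,3)] by (simp add: sum_nonneg)
      then have "norm z \<le> norm x"
        by (rule power2_le_imp_le) simp
      then have "s k * norm z \<le> s k * (norm x + 1)"
        by (intro mult_left_mono) (auto simp: s_def)
      moreover have "s k * (norm x + 1) < \<epsilon>"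
        using k by (subst (asm) pos_less_divide_eq) (auto simp: add_nonneg_pos)
      ultimately show ?thesis
        by (simp add: dist_norm norm_minus_commute)
    qed
    then show "\<exists>F. finite F \<and> F \<subseteq> N \<and> (\<forall>G. finite G \<and> F \<subseteq> G \<and> G \<subseteq> N \<longrightarrow>
        dist (\<Sum>n\<in>G. (complex_of_real (s n) * cinner x (e n)) *\<^sub>C f n) (T x) < \<epsilon>)"
      by (intro exI[of _ "{n\<in>N. n < k}"]) auto
  qed
  have "canonical_decomposition T N s e f"
    using on_e \<open>orthonormal_on N f\<close> expansion by (auto simp: canonical_decomposition_def N_def)
  then show thesis by (rule that)
qed

section \<open>Bessel families and the Schatten classes\<close>

definition bessel_family :: "'k set \<Rightarrow> ('k \<Rightarrow> 'a::complex_hilbert_space) \<Rightarrow> real \<Rightarrow> bool"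
  where "bessel_family I u B \<longleftrightarrow> 0 < B \<and>
    (\<forall>F x. finite F \<longrightarrow> F \<subseteq> I \<longrightarrow> (\<Sum>i\<in>F. (cmod (cinner x (u i)))\<^sup>2) \<le> B * (norm x)\<^sup>2)"

lemma bessel_family_pos: "bessel_family I u B \<Longrightarrow> 0 < B"
  by (simp add: bessel_family_def)

lemma bessel_family_bound:
  "bessel_family I u B \<Longrightarrow> finite F \<Longrightarrow> F \<subseteq> I \<Longrightarrow> (\<Sum>i\<in>F. (cmod (cinner x (u i)))\<^sup>2) \<le> B * (norm x)\<^sup>2"
  by (simp add: bessel_family_def)

lemma bessel_family_norm_le:
  assumes "bessel_family I u B" "i \<in> I"
  shows "(norm (u i))\<^sup>2 \<le> B"
proof (cases "u i = 0")
  case True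
  then show ?thesis using bessel_family_pos[OF assms(1)] by simp
next
  case False
  have "(norm (u i))\<^sup>2 * (norm (u i))\<^sup>2 \<le> B * (norm (u i))\<^sup>2"
    using bessel_family_bound[OF assms(1), of "{i}" "u i"] assms(2)
    by (simp add: cinner_self norm_mult power2_eq_square)
  then show ?thesis using False by (simp only: mult_le_cancel_right) auto
qed

lemma bessel_sum_norm_le:
  fixes g :: "'k \<Rightarrow> 'b::complex_hilbert_space"
  assumes "bessel_family I u B" "finite G" "G \<subseteq> I" "(\<Sum>i\<in>G. (norm (g i))\<^sup>2) \<le> S"
  shows "(\<Sum>i\<in>G. norm (cinner x (u i) *\<^sub>C g i)) \<le> sqrt B * norm x * sqrt S"
proof -
  have "(\<Sum>i\<in>G. norm (cinner x (u i) *\<^sub>C g i)) = (\<Sum>i\<in>G. cmod (cinner x (u i)) * norm (g i))"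
    by (simp add: norm_scaleC)
  also have "\<dots> \<le> sqrt (B * (norm x)\<^sup>2) * sqrt S"
    by (rule sum_mult_le_sqrt[OF bessel_family_bound[OF assms(1-3)] assms(4)])
  finally show ?thesis by (simp add: real_sqrt_mult)
qed

lemma bessel_sum_abs_summable:
  fixes g :: "'k \<Rightarrow> 'b::complex_hilbert_space"
  assumes "bessel_family I u B" "(\<lambda>i. (norm (g i))\<^sup>2) summable_on I"
  shows "(\<lambda>i. cinner x (u i) *\<^sub>C g i) abs_summable_on I"
proof (rule nonneg_summable_on_boundedI(1))
  fix F assume F: "finite F" "F \<subseteq> I"
  show "(\<Sum>i\<in>F. norm (cinner x (u i) *\<^sub>C g i)) \<le> sqrt B * norm x * sqrt (\<Sum>\<^sub>\<infinity>i\<in>I. (norm (g i))\<^sup>2)"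
    by (rule bessel_sum_norm_le[OF assms(1) F]) (use assms(2) F in \<open>simp add: finite_sum_le_infsum\<close>)
qed simp

lemma bounded_clinear_bessel_sum:
  fixes g :: "'k \<Rightarrow> 'b::complex_hilbert_space" and u :: "'k \<Rightarrow> 'a::complex_hilbert_space"
  assumes "bessel_family I u B" "(\<lambda>i. (norm (g i))\<^sup>2) summable_on I"
  shows "bounded_clinear (\<lambda>x. \<Sum>\<^sub>\<infinity>i\<in>I. cinner x (u i) *\<^sub>C g i)"
proof -
  define U where "U x = (\<Sum>\<^sub>\<infinity>i\<in>I. cinner x (u i) *\<^sub>C g i)" for x
  have U: "((\<lambda>i. cinner x (u i) *\<^sub>C g i) has_sum U x) I" for x
    unfolding U_def by (rule has_sum_infsum[OF abs_summable_summable[OF bessel_sum_abs_summable[OF assms]]])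
  have add: "U (x + y) = U x + U y" for x y
    using has_sum_add[OF U[of x] U[of y]] has_sum_unique[OF U[of "x + y"]]
    by (simp add: cinner_add_left scaleC_add_left)
  have scale: "U (c *\<^sub>C x) = c *\<^sub>C U x" for c x
    using has_sum_bounded_linear[OF bounded_linear_scaleC_right[of c] U[of x]] has_sum_unique[OF U[of "c *\<^sub>C x"]]
    by (simp add: cinner_scaleC_left scaleC_scaleC)
  have "norm (U x) \<le> norm x * (sqrt B * sqrt (\<Sum>\<^sub>\<infinity>i\<in>I. (norm (g i))\<^sup>2))" for x
  proof (rule has_sum_norm_bound[OF U])
    fix F assume F: "finite F" "F \<subseteq> I"
    have "norm (\<Sum>i\<in>F. cinner x (u i) *\<^sub>C g i) \<le> (\<Sum>i\<in>F. norm (cinner x (u i) *\<^sub>C g i))"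
      by (rule norm_sum)
    also have "\<dots> \<le> sqrt B * norm x * sqrt (\<Sum>\<^sub>\<infinity>i\<in>I. (norm (g i))\<^sup>2)"
      by (rule bessel_sum_norm_le[OF assms(1) F]) (use assms(2) F in \<open>simp add: finite_sum_le_infsum\<close>)
    finally show "norm (\<Sum>i\<in>F. cinner x (u i) *\<^sub>C g i)
        \<le> norm x * (sqrt B * sqrt (\<Sum>\<^sub>\<infinity>i\<in>I. (norm (g i))\<^sup>2))"
      by (simp add: mult_ac)
  qed
  then have "bounded_linear U"
    by (intro bounded_linear_intro add)
       (simp_all only: scaleR_scaleC[where 'a = 'a] scaleR_scaleC[where 'a = 'b] scale)
  with scale show ?thesis
    unfolding bounded_clinear_def U_def by blast
qed

lemma finite_combinations_in_compact:
  fixes g :: "'k \<Rightarrow> 'b::complex_hilbert_space"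
  assumes "finite F"
  shows "\<exists>C. compact C \<and> (\<forall>c. (\<forall>i\<in>F. cmod (c i) \<le> r) \<longrightarrow> (\<Sum>i\<in>F. c i *\<^sub>C g i) \<in> C)"
  using assms
proof induction
  case empty
  then show ?case by (intro exI[of _ "{0}"]) simp
next
  case (insert i F)
  then obtain C where C: "compact C" "\<And>c. \<forall>i\<in>F. cmod (c i) \<le> r \<Longrightarrow> (\<Sum>i\<in>F. c i *\<^sub>C g i) \<in> C"
    by blast
  have "compact ((\<lambda>c. c *\<^sub>C g i) ` cball 0 r)"
    by (intro compact_continuous_image linear_continuous_on bounded_linear_scaleC_left compact_cball)
  then have "compact {x + y | x y. x \<in> (\<lambda>c. c *\<^sub>C g i) ` cball 0 r \<and> y \<in> C}"
    using C(1) by (rule compact_sums)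
  moreover have "(\<Sum>j\<in>insert i F. c j *\<^sub>C g j) \<in> {x + y | x y. x \<in> (\<lambda>c. c *\<^sub>C g i) ` cball 0 r \<and> y \<in> C}"
    if "\<forall>j\<in>insert i F. cmod (c j) \<le> r" for c
  proof -
    have "c i *\<^sub>C g i \<in> (\<lambda>c. c *\<^sub>C g i) ` cball 0 r" and "(\<Sum>j\<in>F. c j *\<^sub>C g j) \<in> C"
      using that by (auto intro!: C(2))
    then show ?thesis
      using insert.hyps by auto
  qed
  ultimately show ?case by blast
qed

text \<open>
  Interpolation between the two exponents, in a form that avoids Hoelder's inequality. Where \<open>b \<le> \<tau> a\<close> the first term suffices.
  Elsewhere \<open>a b \<le> \<tau>\<^sup>1\<^sup>-\<^sup>p a\<^sup>2\<^sup>-\<^sup>p b\<^sup>p\<close>, and \<open>a\<^sup>2\<^sup>-\<^sup>p (b / \<gamma>)\<^sup>p\<close> is at most the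
  square of the larger of \<open>a\<close> and \<open>b / \<gamma>\<close>.
\<close>

lemma product_le_interpolation:
  fixes a b \<gamma> \<tau> p :: real
  assumes "1 \<le> p" "p \<le> 2" "0 \<le> a" "0 \<le> b" "0 \<le> \<gamma>" "0 < \<tau>" "\<gamma> = 0 \<Longrightarrow> b = 0"
  shows "a * b \<le> \<tau> * a\<^sup>2 + \<tau> powr (1 - p) * (\<gamma> powr p * (a\<^sup>2 + (b / \<gamma>)\<^sup>2))"
proof (cases "b \<le> \<tau> * a")
  case True
  then have "a * b \<le> a * (\<tau> * a)"
    using assms by (intro mult_left_mono)
  then have "a * b \<le> \<tau> * a\<^sup>2"
    by (simp add: power2_eq_square mult_ac)
  moreover have "0 \<le> \<tau> powr (1 - p) * (\<gamma> powr p * (a\<^sup>2 + (b / \<gamma>)\<^sup>2))"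
    by simp
  ultimately show ?thesis by linarith
next
  case b: False
  show ?thesis
  proof (cases "a = 0")
    case True
    then show ?thesis by simp
  next
    case False
    then have a: "a > 0" using assms by simp
    then have "b > 0" using b assms
      by (smt (verit) mult_pos_pos)
    then have \<gamma>: "\<gamma> > 0" using assms by force
    define t c m where "t = b / a" and "c = b / \<gamma>" and "m = max a c"
    have pos: "t > 0" "c > 0" "m > 0"
      using a \<open>b > 0\<close> \<gamma> by (auto simp: t_def c_def m_def)
    have "a\<^sup>2 * t powr p = a powr 2 * (b powr p / a powr p)"
      using a \<open>b > 0\<close> by (simp add: t_def powr_divide)
    also have "\<dots> = a powr (2 - p) * b powr p"
      by (simp add: powr_diff)
    also have "b = \<gamma> * c"
      using \<gamma> by (simp add: c_def)
    also have "(\<gamma> * c) powr p = \<gamma> powr p * c powr p"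
      using \<gamma> pos by (simp add: powr_mult)
    finally have eq: "a\<^sup>2 * t powr p = \<gamma> powr p * (a powr (2 - p) * c powr p)"
      by simp
    have "t = t powr (1 - p) * t powr p"
      using pos by (simp add: powr_add[symmetric])
    also have "\<dots> \<le> \<tau> powr (1 - p) * t powr p"
      using b a assms by (intro mult_right_mono powr_mono2') (auto simp: t_def field_simps)
    finally have t: "t \<le> \<tau> powr (1 - p) * t powr p" .
    have "a * b = a\<^sup>2 * t"
      using a by (simp add: t_def power2_eq_square)
    also have "\<dots> \<le> a\<^sup>2 * (\<tau> powr (1 - p) * t powr p)"
      using t by (rule mult_left_mono) simp
    also have "\<dots> = \<tau> powr (1 - p) * (\<gamma> powr p * (a powr (2 - p) * c powr p))"
      by (simp only: mult.left_commute[of "a\<^sup>2"] eq)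
    finally have ab: "a * b \<le> \<tau> powr (1 - p) * (\<gamma> powr p * (a powr (2 - p) * c powr p))" .
    have "a powr (2 - p) * c powr p \<le> m powr (2 - p) * m powr p"
      using assms a pos by (intro mult_mono powr_mono2) (auto simp: m_def)
    also have "\<dots> = m\<^sup>2"
      using pos by (simp add: powr_add[symmetric])
    also have "m\<^sup>2 \<le> a\<^sup>2 + c\<^sup>2"
      by (simp add: m_def max_def)
    finally have "\<tau> powr (1 - p) * (\<gamma> powr p * (a powr (2 - p) * c powr p))
        \<le> \<tau> powr (1 - p) * (\<gamma> powr p * (a\<^sup>2 + c\<^sup>2))"
      by (intro mult_left_mono) auto
    moreover have "0 \<le> \<tau> * a\<^sup>2"
      using assms by simp
    ultimately show ?thesis
      using ab unfolding c_def by linarith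
  qed
qed

text \<open>
  An operator \<open>x \<mapsto> \<Sum>\<^sub>i \<langle>x, u\<^sub>i\<rangle> g\<^sub>i\<close> with \<open>(u\<^sub>i)\<close> Bessel and \<open>(\<parallel>g\<^sub>i\<parallel>)\<close> square summable is the limit in operator norm of its
  finite partial sums, so the image of the ball is uniformly close to compact sets.
\<close>

lemma compact_operator_bessel_sum:
  fixes T :: "'a::complex_hilbert_space \<Rightarrow> 'b::complex_hilbert_space"
  assumes T: "bounded_clinear T" and u: "bessel_family I u B"
    and g: "(\<lambda>i. (norm (g i))\<^sup>2) summable_on I"
    and sum: "\<And>x. ((\<lambda>i. cinner x (u i) *\<^sub>C g i) has_sum T x) I"
  shows "compact_operator T"
  unfolding compact_operator_def compact_eq_totally_bounded
proof (intro conjI allI impI T)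
  show "complete (closure (T ` cball 0 1))"
    by (simp add: complete_eq_closed)
  fix \<epsilon> :: real assume "\<epsilon> > 0"
  have B: "B > 0" using u by (rule bessel_family_pos)
  obtain F where F: "finite F" "F \<subseteq> I"
    and tail: "\<And>G. finite G \<Longrightarrow> G \<subseteq> I - F \<Longrightarrow> (\<Sum>i\<in>G. (norm (g i))\<^sup>2) \<le> (\<epsilon> / (4 * sqrt B))\<^sup>2"
    by (rule nonneg_summable_on_tail[OF g, of "(\<epsilon> / (4 * sqrt B))\<^sup>2"]) (use \<open>\<epsilon> > 0\<close> B in auto)
  obtain C where C: "compact C" "\<And>c. \<forall>i\<in>F. cmod (c i) \<le> sqrt B \<Longrightarrow> (\<Sum>i\<in>F. c i *\<^sub>C g i) \<in> C"
    using finite_combinations_in_compact[OF F(1), of "sqrt B" g] by blast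
  obtain k where k: "finite k" "C \<subseteq> (\<Union>x\<in>k. ball x (\<epsilon> / 4))"
    using C(1) \<open>\<epsilon> > 0\<close> unfolding compact_eq_totally_bounded by (meson divide_pos_pos zero_less_numeral)
  have "T ` cball 0 1 \<subseteq> (\<Union>x\<in>k. cball x (\<epsilon> / 2))"
  proof
    fix y assume "y \<in> T ` cball 0 1"
    then obtain x where y: "y = T x" and x: "norm x \<le> 1" by auto
    define v where "v = (\<Sum>i\<in>F. cinner x (u i) *\<^sub>C g i)"
    have "norm (y - v) \<le> \<epsilon> / 4"
      unfolding y v_def
    proof (rule has_sum_remainder_bound[OF sum F])
      fix G assume G: "finite G" "G \<subseteq> I - F"
      have "norm (\<Sum>i\<in>G. cinner x (u i) *\<^sub>C g i) \<le> (\<Sum>i\<in>G. norm (cinner x (u i) *\<^sub>C g i))"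
        by (rule norm_sum)
      also have "\<dots> \<le> sqrt B * norm x * sqrt ((\<epsilon> / (4 * sqrt B))\<^sup>2)"
        using G by (intro bessel_sum_norm_le[OF u _ _ tail]) auto
      also have "\<dots> = \<epsilon> / 4 * norm x"
        using B \<open>\<epsilon> > 0\<close> by simp
      also have "\<dots> \<le> \<epsilon> / 4"
        using x \<open>\<epsilon> > 0\<close> by simp
      finally show "norm (\<Sum>i\<in>G. cinner x (u i) *\<^sub>C g i) \<le> \<epsilon> / 4" .
    qed
    moreover have "v \<in> C"
      unfolding v_def
    proof (rule C(2), rule ballI)
      fix i assume "i \<in> F"
      have "cmod (cinner x (u i)) \<le> norm x * norm (u i)"
        by (rule cinner_Cauchy_Schwarz)
      also have "\<dots> \<le> norm (u i)"
        using x by (simp add: mult_left_le_one_le)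
      also have "\<dots> \<le> sqrt B"
        using bessel_family_norm_le[OF u, of i] F \<open>i \<in> F\<close> by (intro real_le_rsqrt) auto
      finally show "cmod (cinner x (u i)) \<le> sqrt B" .
    qed
    then obtain z where "z \<in> k" "dist z v < \<epsilon> / 4"
      using k(2) by (auto simp: dist_commute)
    ultimately have "dist z y \<le> \<epsilon> / 2"
      using dist_triangle[of z y v] by (simp add: dist_norm norm_minus_commute)
    then show "y \<in> (\<Union>x\<in>k. cball x (\<epsilon> / 2))"
      using \<open>z \<in> k\<close> by auto
  qed
  then have "closure (T ` cball 0 1) \<subseteq> (\<Union>x\<in>k. cball x (\<epsilon> / 2))"
    by (rule closure_minimal) (use k(1) in \<open>auto intro!: closed_UN\<close>)
  also have "\<dots> \<subseteq> (\<Union>x\<in>k. ball x \<epsilon>)"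
    using \<open>\<epsilon> > 0\<close> by (force simp: dist_commute)
  finally show "\<exists>k. finite k \<and> closure (T ` cball 0 1) \<subseteq> (\<Union>x\<in>k. ball x \<epsilon>)"
    using k(1) by blast
qed

lemma summable_powr_imp_summable_square:
  fixes \<gamma> :: "'k \<Rightarrow> real"
  assumes "1 \<le> p" "p \<le> 2" "\<And>i. i \<in> I \<Longrightarrow> 0 \<le> \<gamma> i" "(\<lambda>i. \<gamma> i powr p) summable_on I"
  shows "(\<lambda>i. (\<gamma> i)\<^sup>2) summable_on I"
proof -
  define M where "M = (\<Sum>\<^sub>\<infinity>i\<in>I. \<gamma> i powr p)"
  have "(\<gamma> i)\<^sup>2 \<le> \<gamma> i powr p * (M powr (1 / p)) powr (2 - p)" if "i \<in> I" for i
  proof (cases "\<gamma> i = 0")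
    case True
    then show ?thesis by simp
  next
    case False
    then have pos: "\<gamma> i > 0" using assms(3)[OF that] by simp
    have "\<gamma> i powr p \<le> M"
      using finite_sum_le_infsum[OF assms(4), of "{i}"] that by (simp add: M_def)
    then have "(\<gamma> i powr p) powr (1 / p) \<le> M powr (1 / p)"
      using assms(1) by (intro powr_mono2) auto
    moreover have "(\<gamma> i powr p) powr (1 / p) = \<gamma> i"
      using assms(1) pos by (simp add: powr_powr)
    ultimately have "\<gamma> i \<le> M powr (1 / p)"
      by (simp only:)
    then have "\<gamma> i powr (2 - p) \<le> (M powr (1 / p)) powr (2 - p)"
      using assms(2) pos by (intro powr_mono2) auto
    moreover have "(\<gamma> i)\<^sup>2 = \<gamma> i powr p * \<gamma> i powr (2 - p)"
      using pos by (simp add: powr_add[symmetric])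
    ultimately show ?thesis
      by (simp only:) (rule mult_left_mono, auto)
  qed
  with summable_on_cmult_left[OF assms(4)] show ?thesis
    by (rule summable_on_comparison_test) auto
qed

text \<open>
  Estimating the singular values \<open>s\<^sub>n = \<langle>T e\<^sub>n, f\<^sub>n\<rangle> = \<Sum>\<^sub>i \<langle>e\<^sub>n, u\<^sub>i\<rangle> \<langle>g\<^sub>i, f\<^sub>n\<rangle>\<close>. The matrices
  \<open>\<langle>e\<^sub>n, u\<^sub>i\<rangle>\<close> and \<open>\<langle>g\<^sub>i, f\<^sub>n\<rangle> / \<parallel>g\<^sub>i\<parallel>\<close> have uniformly square summable columns by
  Bessel's inequality, and the rows of the first are uniformly square summable as well. The interpolation
  inequality with \<open>\<tau> = s\<^sub>n / (2 B)\<close> bounds the sum: its first terms contribute at most \<open>s\<^sub>n / 2\<close> and are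
  absorbed, the others are summed over \<open>n\<close> first.
\<close>

theorem singular_values_powr_summable:
  fixes T :: "'a::complex_hilbert_space \<Rightarrow> 'b::complex_hilbert_space"
  assumes cd: "canonical_decomposition T N s e f" and p: "1 \<le> p" "p \<le> 2"
    and u: "bessel_family I u B" and g: "(\<lambda>i. norm (g i) powr p) summable_on I"
    and sum: "\<And>x. ((\<lambda>i. cinner x (u i) *\<^sub>C g i) has_sum T x) I"
  shows "(\<lambda>n. s n powr p) summable_on N"
proof (rule nonneg_summable_on_boundedI(1))
  fix L assume L: "finite L" "L \<subseteq> N"
  have on: "orthonormal_on N e" "orthonormal_on N f" and s: "\<And>n. n \<in> N \<Longrightarrow> 0 < s n"
    and exp: "\<And>x. ((\<lambda>n. (complex_of_real (s n) * cinner x (e n)) *\<^sub>C f n) has_sum T x) N"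
    using cd by (auto simp: canonical_decomposition_def)
  have B: "B > 0" using u by (rule bessel_family_pos)
  define a b where "a n i = cmod (cinner (e n) (u i))" and "b n i = cmod (cinner (g i) (f n))" for n i
  define \<gamma> where "\<gamma> i = norm (g i)" for i
  have Te: "T (e n) = complex_of_real (s n) *\<^sub>C f n" if n: "n \<in> N" for n
  proof -
    have "((\<lambda>m. (complex_of_real (s m) * cinner (e n) (e m)) *\<^sub>C f m) has_sum complex_of_real (s n) *\<^sub>C f n) N"
      using on(1) n by (intro has_sum_finite_neutralI[of "{n}"]) (auto simp: orthonormal_on_def)
    then show ?thesis
      using exp has_sum_unique by blast
  qed
  have sn: "((\<lambda>i. cinner (e n) (u i) * cinner (g i) (f n)) has_sum complex_of_real (s n)) I" if "n \<in> N" for n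
  proof -
    have "cinner (T (e n)) (f n) = complex_of_real (s n)"
      using on(2) that by (simp add: Te cinner_scaleC_left orthonormal_on_def)
    with has_sum_bounded_linear[OF bounded_linear_cinner_left[of "f n"] sum[of "e n"]] show ?thesis
      by (simp add: cinner_scaleC_left)
  qed
  (* One finite set of indices i serves all n in L: all estimates are then about finite matrices, at the
     price of replacing s n by 3/4 s n, of which s n / 2 will be absorbed. *)
  have "\<exists>F. finite F \<and> F \<subseteq> I \<and> (\<forall>G. finite G \<and> F \<subseteq> G \<and> G \<subseteq> I \<longrightarrow>
      dist (\<Sum>i\<in>G. cinner (e n) (u i) * cinner (g i) (f n)) (complex_of_real (s n)) < s n / 4)" if "n \<in> L" for n
  proof -
    have "n \<in> N" using that L(2) by blast
    then have "\<forall>\<^sub>F G in finite_subsets_at_top I.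
        dist (\<Sum>i\<in>G. cinner (e n) (u i) * cinner (g i) (f n)) (complex_of_real (s n)) < s n / 4"
      using s by (intro tendstoD[OF sn[unfolded has_sum_def]]) simp_all
    then show ?thesis
      unfolding eventually_finite_subsets_at_top .
  qed
  then obtain \<F> where \<F>: "\<And>n. n \<in> L \<Longrightarrow> finite (\<F> n)" "\<And>n. n \<in> L \<Longrightarrow> \<F> n \<subseteq> I"
    "\<And>n G. n \<in> L \<Longrightarrow> finite G \<Longrightarrow> \<F> n \<subseteq> G \<Longrightarrow> G \<subseteq> I \<Longrightarrow>
      dist (\<Sum>i\<in>G. cinner (e n) (u i) * cinner (g i) (f n)) (complex_of_real (s n)) < s n / 4"
    by metis
  define F where "F = (\<Union>n\<in>L. \<F> n)"
  have F: "finite F" "F \<subseteq> I"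
    using L \<F> by (auto simp: F_def)
  have a_row: "(\<Sum>i\<in>F. (a n i)\<^sup>2) \<le> B" if "n \<in> L" for n
  proof -
    have "cinner (e n) (e n) = 1"
      using on(1) that L(2) by (auto simp: orthonormal_on_def)
    then have "(norm (e n))\<^sup>2 = 1"
      by (simp add: norm_square_eq_Re_cinner)
    then show ?thesis
      using bessel_family_bound[OF u F, of "e n"] by (simp add: a_def)
  qed
  have a_column: "(\<Sum>n\<in>L. (a n i)\<^sup>2) \<le> B" if "i \<in> F" for i
  proof -
    have "(\<Sum>n\<in>L. (a n i)\<^sup>2) = (\<Sum>n\<in>L. (cmod (cinner (u i) (e n)))\<^sup>2)"
      unfolding a_def by (intro sum.cong refl) (metis cinner_commute complex_mod_cnj)
    also have "\<dots> \<le> (norm (u i))\<^sup>2"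
      by (rule Bessel_inequality[OF on(1) L])
    also have "\<dots> \<le> B"
      using bessel_family_norm_le[OF u] that F by blast
    finally show ?thesis .
  qed
  have b_column: "(\<Sum>n\<in>L. (b n i / \<gamma> i)\<^sup>2) \<le> 1" for i
  proof -
    have "(\<Sum>n\<in>L. (b n i / \<gamma> i)\<^sup>2) = (\<Sum>n\<in>L. (cmod (cinner (g i) (f n)))\<^sup>2) / (\<gamma> i)\<^sup>2"
      by (simp add: b_def power_divide sum_divide_distrib)
    also have "\<dots> \<le> (norm (g i))\<^sup>2 / (\<gamma> i)\<^sup>2"
      by (intro divide_right_mono Bessel_inequality[OF on(2) L]) simp
    also have "\<dots> \<le> 1"
      by (simp add: \<gamma>_def)
    finally show ?thesis .
  qed
  have single: "s n powr p \<le> 4 * (2 * B) powr (p - 1) * (\<Sum>i\<in>F. \<gamma> i powr p * ((a n i)\<^sup>2 + (b n i / \<gamma> i)\<^sup>2))"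
    (is "_ \<le> _ * ?R") if n: "n \<in> L" for n
  proof -
    define \<tau> where "\<tau> = s n / (2 * B)"
    have "s n > 0" and \<tau>: "\<tau> > 0"
      using s[of n] n L(2) B by (auto simp: \<tau>_def)
    define z where "z = (\<Sum>i\<in>F. cinner (e n) (u i) * cinner (g i) (f n))"
    have "dist z (complex_of_real (s n)) < s n / 4"
      unfolding z_def using n F by (intro \<F>(3)) (auto simp: F_def)
    then have "3 / 4 * s n \<le> cmod z"
      using norm_triangle_ineq2[of "complex_of_real (s n)" z] \<open>s n > 0\<close>
      by (simp add: dist_norm norm_minus_commute)
    also have "\<dots> \<le> (\<Sum>i\<in>F. a n i * b n i)"
      unfolding z_def a_def b_def by (rule order_trans[OF norm_sum]) (simp add: norm_mult)
    also have "\<dots> \<le> (\<Sum>i\<in>F. \<tau> * (a n i)\<^sup>2 + \<tau> powr (1 - p) * (\<gamma> i powr p * ((a n i)\<^sup>2 + (b n i / \<gamma> i)\<^sup>2)))"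
      by (intro sum_mono product_le_interpolation p \<tau>) (auto simp: a_def b_def \<gamma>_def cinner_zero_left)
    also have "\<dots> = \<tau> * (\<Sum>i\<in>F. (a n i)\<^sup>2) + \<tau> powr (1 - p) * ?R"
      by (simp add: sum.distrib sum_distrib_left)
    also have "\<tau> * (\<Sum>i\<in>F. (a n i)\<^sup>2) \<le> \<tau> * B"
      using a_row[OF n] \<tau> by (intro mult_left_mono) auto
    also have "\<tau> * B = s n / 2"
      using B by (simp add: \<tau>_def)
    finally have le: "s n \<le> 4 * (\<tau> powr (1 - p) * ?R)" by simp
    have cancel: "s n powr (p - 1) * \<tau> powr (1 - p) = (2 * B) powr (p - 1)"
    proof -
      have "s n powr (p - 1) * \<tau> powr (1 - p) = s n powr (p - 1) / \<tau> powr (p - 1)"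
        by (metis minus_diff_eq powr_minus_divide times_divide_eq_right mult.right_neutral)
      also have "\<dots> = (s n / \<tau>) powr (p - 1)"
        using \<open>s n > 0\<close> \<tau> by (simp add: powr_divide)
      also have "s n / \<tau> = 2 * B"
        using \<open>s n > 0\<close> by (simp add: \<tau>_def)
      finally show ?thesis .
    qed
    have "s n powr p = s n powr (p - 1) * s n"
      using \<open>s n > 0\<close> powr_add[of "s n" "p - 1" 1] by simp
    also have "\<dots> \<le> s n powr (p - 1) * (4 * (\<tau> powr (1 - p) * ?R))"
      using le by (rule mult_left_mono) simp
    also have "\<dots> = 4 * (s n powr (p - 1) * \<tau> powr (1 - p)) * ?R"
      by (simp only: mult.assoc mult.left_commute[of "s n powr (p - 1)" 4])
    finally show ?thesis
      unfolding cancel .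
  qed
  have "(\<Sum>n\<in>L. s n powr p) \<le>
      (\<Sum>n\<in>L. 4 * (2 * B) powr (p - 1) * (\<Sum>i\<in>F. \<gamma> i powr p * ((a n i)\<^sup>2 + (b n i / \<gamma> i)\<^sup>2)))"
    by (intro sum_mono single)
  also have "\<dots> = 4 * (2 * B) powr (p - 1) *
      (\<Sum>i\<in>F. \<gamma> i powr p * ((\<Sum>n\<in>L. (a n i)\<^sup>2) + (\<Sum>n\<in>L. (b n i / \<gamma> i)\<^sup>2)))"
    unfolding sum_distrib_left[symmetric] by (subst sum.swap) (simp only: sum_distrib_left[symmetric] sum.distrib)
  also have "\<dots> \<le> 4 * (2 * B) powr (p - 1) * (\<Sum>i\<in>F. \<gamma> i powr p * (B + 1))"
    by (intro mult_left_mono sum_mono add_mono a_column b_column) auto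
  also have "\<dots> = 4 * (2 * B) powr (p - 1) * ((\<Sum>i\<in>F. \<gamma> i powr p) * (B + 1))"
    by (simp add: sum_distrib_right)
  also have "\<dots> \<le> 4 * (2 * B) powr (p - 1) * ((\<Sum>\<^sub>\<infinity>i\<in>I. \<gamma> i powr p) * (B + 1))"
    using g F B by (intro mult_left_mono mult_right_mono finite_sum_le_infsum) (auto simp: \<gamma>_def)
  finally show "(\<Sum>n\<in>L. s n powr p) \<le> 4 * (2 * B) powr (p - 1) * ((\<Sum>\<^sub>\<infinity>i\<in>I. \<gamma> i powr p) * (B + 1))" .
qed simp

corollary bessel_sum_in_schatten_class:
  fixes T :: "'a::complex_hilbert_space \<Rightarrow> 'b::complex_hilbert_space"
  assumes T: "bounded_clinear T" and p: "1 \<le> p" "p \<le> 2"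
    and u: "bessel_family I u B" and g: "(\<lambda>i. norm (g i) powr p) summable_on I"
    and sum: "\<And>x. ((\<lambda>i. cinner x (u i) *\<^sub>C g i) has_sum T x) I"
  shows "T \<in> schatten_class p"
proof -
  have "(\<lambda>i. (norm (g i))\<^sup>2) summable_on I"
    using summable_powr_imp_summable_square[OF p _ g] by simp
  then have "compact_operator T"
    by (rule compact_operator_bessel_sum[OF T u _ sum])
  moreover then obtain N s e f where "canonical_decomposition T N s e f"
    by (rule compact_operator_canonical_decomposition)
  moreover from this have "(\<lambda>n. s n powr p) summable_on N"
    by (rule singular_values_powr_summable[OF _ p u g sum])
  ultimately show ?thesis
    by (auto simp: schatten_class_def)
qed

lemma has_sum_Plus:
  assumes "(f has_sum a) I" "(g has_sum b) J"
  shows "(case_sum f g has_sum (a + b :: 'c::topological_comm_monoid_add)) (I <+> J)"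
  unfolding Plus_def
proof (rule has_sum_Un_disjoint)
  show "(case_sum f g has_sum a) (Inl ` I)"
    using assms(1) by (subst has_sum_reindex) (auto simp: o_def)
  show "(case_sum f g has_sum b) (Inr ` J)"
    using assms(2) by (subst has_sum_reindex) (auto simp: o_def)
qed auto

lemma bessel_family_Plus:
  assumes "bessel_family I u B" "bessel_family J v C"
  shows "bessel_family (I <+> J) (case_sum u v) (B + C)"
  unfolding bessel_family_def
proof (intro conjI allI impI)
  show "0 < B + C"
    using assms by (simp add: bessel_family_def)
  fix F x assume F: "finite F" "F \<subseteq> I <+> J"
  have fin: "finite (Inl -` F)" "finite (Inr -` F)"
    using F(1) by (auto intro!: finite_vimageI)
  have split: "F = (Inl -` F) <+> (Inr -` F)"
    by (auto simp: Plus_def image_iff) (metis sum.exhaust)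
  have "(\<Sum>i\<in>F. (cmod (cinner x (case_sum u v i)))\<^sup>2) =
      (\<Sum>i\<in>Inl -` F. (cmod (cinner x (u i)))\<^sup>2) + (\<Sum>j\<in>Inr -` F. (cmod (cinner x (v j)))\<^sup>2)"
    by (subst split, subst sum.Plus[OF fin]) (simp add: o_def)
  also have "\<dots> \<le> B * (norm x)\<^sup>2 + C * (norm x)\<^sup>2"
    using F by (intro add_mono bessel_family_bound[OF assms(1)] bessel_family_bound[OF assms(2)] fin) auto
  finally show "(\<Sum>i\<in>F. (cmod (cinner x (case_sum u v i)))\<^sup>2) \<le> (B + C) * (norm x)\<^sup>2"
    by (simp add: distrib_right)
qed

lemma bessel_family_finite:
  fixes v :: "'k \<Rightarrow> 'a::complex_hilbert_space"
  assumes "finite J"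
  shows "bessel_family J v (1 + (\<Sum>j\<in>J. (norm (v j))\<^sup>2))"
  unfolding bessel_family_def
proof (intro conjI allI impI)
  show "0 < 1 + (\<Sum>j\<in>J. (norm (v j))\<^sup>2)"
    by (simp add: add_pos_nonneg sum_nonneg)
  fix F x assume F: "finite F" "F \<subseteq> J"
  have "(\<Sum>j\<in>F. (cmod (cinner x (v j)))\<^sup>2) \<le> (\<Sum>j\<in>F. (norm x * norm (v j))\<^sup>2)"
    by (intro sum_mono power_mono cinner_Cauchy_Schwarz) simp
  also have "\<dots> \<le> (\<Sum>j\<in>J. (norm x * norm (v j))\<^sup>2)"
    using F assms by (intro sum_mono2) auto
  also have "\<dots> = (norm x)\<^sup>2 * (\<Sum>j\<in>J. (norm (v j))\<^sup>2)"
    by (simp add: power_mult_distrib sum_distrib_left)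
  finally show "(\<Sum>j\<in>F. (cmod (cinner x (v j)))\<^sup>2) \<le> (1 + (\<Sum>j\<in>J. (norm (v j))\<^sup>2)) * (norm x)\<^sup>2"
    by (simp add: algebra_simps add_increasing)
qed

section \<open>Frames and their canonical duals\<close>

lemma bessel_synthesis_norm_le:
  assumes u: "bessel_family I u B" and F: "finite F" "F \<subseteq> I" and S: "(\<Sum>i\<in>F. (cmod (c i))\<^sup>2) \<le> S"
  shows "norm (\<Sum>i\<in>F. c i *\<^sub>C u i) \<le> sqrt B * sqrt S"
proof (cases "(\<Sum>i\<in>F. c i *\<^sub>C u i) = 0")
  case True
  have "0 \<le> S" by (rule order_trans[OF sum_nonneg S]) simp
  then show ?thesis using True bessel_family_pos[OF u] by simp
next
  case False
  define v where "v = (\<Sum>i\<in>F. c i *\<^sub>C u i)"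
  have "(norm v)\<^sup>2 = cmod (cinner v v)"
    by (simp add: cinner_self norm_power)
  also have "\<dots> = cmod (\<Sum>i\<in>F. c i * cinner (u i) v)"
    by (subst (1) v_def) (simp only: cinner_sum_left cinner_scaleC_left)
  also have "\<dots> \<le> (\<Sum>i\<in>F. cmod (c i * cinner (u i) v))"
    by (rule norm_sum)
  also have "\<dots> = (\<Sum>i\<in>F. cmod (c i) * cmod (cinner v (u i)))"
    unfolding norm_mult by (intro sum.cong refl arg_cong2[where f = "(*)"]) (metis cinner_commute complex_mod_cnj)
  also have "\<dots> \<le> sqrt S * sqrt (B * (norm v)\<^sup>2)"
    by (rule sum_mult_le_sqrt[OF S bessel_family_bound[OF u F]])
  finally have "norm v * norm v \<le> (sqrt B * sqrt S) * norm v"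
    by (simp add: real_sqrt_mult power2_eq_square mult_ac)
  then show ?thesis
    using False by (simp add: v_def)
qed

lemma bessel_synthesis_summable:
  assumes u: "bessel_family I u B" and c: "(\<lambda>i. (cmod (c i))\<^sup>2) summable_on I"
  shows "(\<lambda>i. c i *\<^sub>C u i) summable_on I"
proof (rule summable_on_CauchyI)
  fix \<epsilon> :: real assume "\<epsilon> > 0"
  have B: "B > 0" using u by (rule bessel_family_pos)
  obtain F where F: "finite F" "F \<subseteq> I"
    and tail: "\<And>G. finite G \<Longrightarrow> G \<subseteq> I - F \<Longrightarrow> (\<Sum>i\<in>G. (cmod (c i))\<^sup>2) \<le> (\<epsilon> / sqrt B)\<^sup>2"
    by (rule nonneg_summable_on_tail[OF c, of "(\<epsilon> / sqrt B)\<^sup>2"]) (use \<open>\<epsilon> > 0\<close> B in auto)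
  have "norm (\<Sum>i\<in>G. c i *\<^sub>C u i) \<le> \<epsilon>" if "finite G" "G \<subseteq> I - F" for G
  proof -
    have "norm (\<Sum>i\<in>G. c i *\<^sub>C u i) \<le> sqrt B * sqrt ((\<epsilon> / sqrt B)\<^sup>2)"
      using that by (intro bessel_synthesis_norm_le[OF u _ _ tail]) auto
    also have "\<dots> = \<epsilon>"
      using \<open>\<epsilon> > 0\<close> B by simp
    finally show ?thesis .
  qed
  with F show "\<exists>F. finite F \<and> F \<subseteq> I \<and> (\<forall>G. finite G \<longrightarrow> G \<subseteq> I - F \<longrightarrow> norm (\<Sum>i\<in>G. c i *\<^sub>C u i) \<le> \<epsilon>)"
    by blast
qed

lemma norm_bessel_synthesis:
  assumes u: "bessel_family I u B" and c: "(\<lambda>i. (cmod (c i))\<^sup>2) summable_on I"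
  shows "norm (\<Sum>\<^sub>\<infinity>i\<in>I. c i *\<^sub>C u i) \<le> sqrt B * sqrt (\<Sum>\<^sub>\<infinity>i\<in>I. (cmod (c i))\<^sup>2)"
proof (rule has_sum_norm_bound[OF has_sum_infsum[OF bessel_synthesis_summable[OF assms]]])
  fix F assume F: "finite F" "F \<subseteq> I"
  show "norm (\<Sum>i\<in>F. c i *\<^sub>C u i) \<le> sqrt B * sqrt (\<Sum>\<^sub>\<infinity>i\<in>I. (cmod (c i))\<^sup>2)"
    by (rule bessel_synthesis_norm_le[OF u F]) (use c F in \<open>simp add: finite_sum_le_infsum\<close>)
qed

locale frame =
  fixes \<Psi> :: "'i::countable \<Rightarrow> 'a::complex_hilbert_space"
  assumes is_frame: "is_frame \<Psi>"
begin

lemma analysis_summable: "(\<lambda>i. (cmod (cinner x (\<Psi> i)))\<^sup>2) summable_on UNIV"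
  using is_frame unfolding is_frame_def by blast

lemma frame_bounds:
  obtains A B where "0 < A" "A \<le> B" "bessel_family UNIV \<Psi> B"
    "\<And>x. A * (norm x)\<^sup>2 \<le> (\<Sum>\<^sub>\<infinity>i. (cmod (cinner x (\<Psi> i)))\<^sup>2)"
    "\<And>x. (\<Sum>\<^sub>\<infinity>i. (cmod (cinner x (\<Psi> i)))\<^sup>2) \<le> B * (norm x)\<^sup>2"
proof -
  obtain A B where AB: "0 < A" "0 < B"
    "\<And>x. A * (norm x)\<^sup>2 \<le> (\<Sum>\<^sub>\<infinity>i. (cmod (cinner x (\<Psi> i)))\<^sup>2)"
    "\<And>x. (\<Sum>\<^sub>\<infinity>i. (cmod (cinner x (\<Psi> i)))\<^sup>2) \<le> B * (norm x)\<^sup>2"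
    using is_frame unfolding is_frame_def by blast
  have upper: "(\<Sum>\<^sub>\<infinity>i. (cmod (cinner x (\<Psi> i)))\<^sup>2) \<le> max A B * (norm x)\<^sup>2" for x
    by (rule order_trans[OF AB(4)]) (simp add: mult_right_mono)
  have "bessel_family UNIV \<Psi> (max A B)"
    unfolding bessel_family_def
  proof (intro conjI allI impI)
    fix F :: "'i set" and x assume "finite F"
    then have "(\<Sum>i\<in>F. (cmod (cinner x (\<Psi> i)))\<^sup>2) \<le> (\<Sum>\<^sub>\<infinity>i. (cmod (cinner x (\<Psi> i)))\<^sup>2)"
      using analysis_summable by (intro finite_sum_le_infsum) auto
    then show "(\<Sum>i\<in>F. (cmod (cinner x (\<Psi> i)))\<^sup>2) \<le> max A B * (norm x)\<^sup>2"
      using upper order_trans by blast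
  qed (use AB in auto)
  then show thesis
    using AB upper by (intro that[of A "max A B"]) auto
qed

lemma frame_complete:
  assumes "\<And>i. cinner x (\<Psi> i) = 0"
  shows "x = 0"
proof -
  obtain A where "0 < A" "A * (norm x)\<^sup>2 \<le> (\<Sum>\<^sub>\<infinity>i. (cmod (cinner x (\<Psi> i)))\<^sup>2)"
    by (rule frame_bounds) blast
  then show ?thesis
    by (simp add: assms mult_le_0_iff)
qed

lemma frame_op_has_sum: "((\<lambda>i. cinner x (\<Psi> i) *\<^sub>C \<Psi> i) has_sum frame_op \<Psi> x) UNIV"
proof -
  obtain B where "bessel_family UNIV \<Psi> B"
    by (rule frame_bounds)
  from has_sum_infsum[OF bessel_synthesis_summable[OF this analysis_summable]] show ?thesis
    by (simp add: frame_op_def synthesis_op_def analysis_op_def)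
qed

lemma frame_op_cinner_has_sum:
  "((\<lambda>i. cinner x (\<Psi> i) * cinner (\<Psi> i) y) has_sum cinner (frame_op \<Psi> x) y) UNIV"
  using has_sum_bounded_linear[OF bounded_linear_cinner_left frame_op_has_sum, of x y]
  by (simp add: cinner_scaleC_left)

lemma frame_op_self_adjoint: "cinner (frame_op \<Psi> x) y = cinner x (frame_op \<Psi> y)"
proof -
  have "((\<lambda>i. cnj (cinner y (\<Psi> i) * cinner (\<Psi> i) x)) has_sum cnj (cinner (frame_op \<Psi> y) x)) UNIV"
    using frame_op_cinner_has_sum[of y x] by (simp only: has_sum_cnj_iff)
  moreover have "cnj (cinner y (\<Psi> i) * cinner (\<Psi> i) x) = cinner x (\<Psi> i) * cinner (\<Psi> i) y" for i
    by (simp add: cinner_commute[of x] cinner_commute[of _ y] mult.commute)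
  ultimately show ?thesis
    using frame_op_cinner_has_sum[of x y] cinner_commute[of x "frame_op \<Psi> y"] has_sum_unique by fastforce
qed

lemma frame_op_diff: "frame_op \<Psi> (x - y) = frame_op \<Psi> x - frame_op \<Psi> y"
proof -
  have "((\<lambda>i. cinner (x - y) (\<Psi> i) *\<^sub>C \<Psi> i + cinner y (\<Psi> i) *\<^sub>C \<Psi> i) has_sum
      frame_op \<Psi> (x - y) + frame_op \<Psi> y) UNIV"
    by (intro has_sum_add frame_op_has_sum)
  then have "((\<lambda>i. cinner x (\<Psi> i) *\<^sub>C \<Psi> i) has_sum frame_op \<Psi> (x - y) + frame_op \<Psi> y) UNIV"
    by (simp flip: scaleC_add_left cinner_add_left)
  then have "frame_op \<Psi> (x - y) + frame_op \<Psi> y = frame_op \<Psi> x"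
    using frame_op_has_sum by (rule has_sum_unique)
  then show ?thesis
    by (simp add: eq_diff_eq)
qed

text \<open>
  The frame operator \<open>S\<close> is bijective since it is coercive, \<open>Re \<langle>S x, x\<rangle> \<ge> A \<parallel>x\<parallel>\<^sup>2\<close>, and bounded by \<open>B\<close>. With the step
  \<open>c = A / B\<^sup>2\<close> the Richardson iteration \<open>x \<mapsto> x - c (S x - y)\<close> contracts with the factor
  \<open>\<surd>(1 - 2 c A + c\<^sup>2 B\<^sup>2) = \<surd>(1 - A\<^sup>2 / B\<^sup>2)\<close>, and its fixed point solves \<open>S x = y\<close>.
\<close>

lemma bij_frame_op: "bij (frame_op \<Psi>)"
proof -
  obtain A B where AB: "0 < A" "A \<le> B" and bessel: "bessel_family UNIV \<Psi> B"
    and lower: "\<And>x. A * (norm x)\<^sup>2 \<le> (\<Sum>\<^sub>\<infinity>i. (cmod (cinner x (\<Psi> i)))\<^sup>2)"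
    and upper: "\<And>x. (\<Sum>\<^sub>\<infinity>i. (cmod (cinner x (\<Psi> i)))\<^sup>2) \<le> B * (norm x)\<^sup>2"
    by (rule frame_bounds) blast
  have coercive: "A * (norm x)\<^sup>2 \<le> Re (cinner x (frame_op \<Psi> x))" for x
  proof -
    have "((\<lambda>i. complex_of_real ((cmod (cinner x (\<Psi> i)))\<^sup>2)) has_sum cinner (frame_op \<Psi> x) x) UNIV"
      using frame_op_cinner_has_sum[of x x] by (simp only: cinner_times_self_swap)
    then have "((\<lambda>i. (cmod (cinner x (\<Psi> i)))\<^sup>2) has_sum Re (cinner (frame_op \<Psi> x) x)) UNIV"
      using has_sum_Re by fastforce
    then show ?thesis
      using lower[of x] by (simp add: infsumI frame_op_self_adjoint)
  qed
  have bounded: "norm (frame_op \<Psi> x) \<le> B * norm x" for x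
  proof -
    have "norm (frame_op \<Psi> x) \<le> sqrt B * sqrt (\<Sum>\<^sub>\<infinity>i. (cmod (cinner x (\<Psi> i)))\<^sup>2)"
      using norm_bessel_synthesis[OF bessel analysis_summable]
      by (simp add: frame_op_def synthesis_op_def analysis_op_def)
    also have "\<dots> \<le> sqrt B * sqrt (B * (norm x)\<^sup>2)"
      using upper AB by (intro mult_left_mono real_sqrt_le_mono) auto
    also have "\<dots> = B * norm x"
      using AB by (simp add: real_sqrt_mult)
    finally show ?thesis .
  qed
  have "inj (frame_op \<Psi>)"
  proof (rule injI)
    fix x y assume "frame_op \<Psi> x = frame_op \<Psi> y"
    then have "A * (norm (x - y))\<^sup>2 \<le> 0"
      using coercive[of "x - y"] by (simp add: frame_op_diff cinner_zero_right)
    then show "x = y"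
      using AB by (simp add: mult_le_0_iff)
  qed
  moreover have "\<exists>x. frame_op \<Psi> x = y" for y
  proof -
    define c where "c = A / B\<^sup>2"
    define q where "q = 1 - A\<^sup>2 / B\<^sup>2"
    have c: "c > 0" using AB by (simp add: c_def)
    have "A\<^sup>2 \<le> B\<^sup>2"
      using AB by (intro power_mono) auto
    then have q: "0 \<le> q" "q < 1"
      using AB by (auto simp: q_def)
    define \<Phi> where "\<Phi> x = x - c *\<^sub>R (frame_op \<Psi> x - y)" for x
    have contract: "dist (\<Phi> x) (\<Phi> z) \<le> sqrt q * dist x z" for x z
    proof -
      define d where "d = x - z"
      have "\<Phi> x - \<Phi> z = d - c *\<^sub>R frame_op \<Psi> d"
        by (simp add: \<Phi>_def d_def frame_op_diff algebra_simps)
      then have "(dist (\<Phi> x) (\<Phi> z))\<^sup>2 = (norm d)\<^sup>2 - 2 * (c * Re (cinner d (frame_op \<Psi> d))) + (c * norm (frame_op \<Psi> d))\<^sup>2"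
        using c by (simp add: dist_norm norm_diff_square) (simp add: scaleR_scaleC cinner_scaleC_right)
      also have "\<dots> \<le> (norm d)\<^sup>2 - 2 * (c * (A * (norm d)\<^sup>2)) + (c * (B * norm d))\<^sup>2"
        using c by (intro add_mono diff_mono mult_left_mono power_mono coercive bounded) auto
      also have "\<dots> = q * (norm d)\<^sup>2"
        using AB by (simp add: c_def q_def field_simps power2_eq_square)
      finally have "sqrt ((dist (\<Phi> x) (\<Phi> z))\<^sup>2) \<le> sqrt (q * (norm d)\<^sup>2)"
        by (rule real_sqrt_le_mono)
      then show ?thesis
        by (simp add: real_sqrt_mult d_def dist_norm)
    qed
    have "\<exists>!x. \<Phi> x = x"
      by (rule banach_fix_type[of "sqrt q"]) (use q contract in auto)
    then obtain x where "\<Phi> x = x" by blast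
    then show ?thesis
      using c by (auto simp: \<Phi>_def)
  qed
  then have "surj (frame_op \<Psi>)"
    unfolding surj_def by metis
  ultimately show ?thesis
    by (simp add: bij_def)
qed

lemma frame_op_inv: "frame_op \<Psi> (inv (frame_op \<Psi>) x) = x"
  by (rule surj_f_inv_f[OF bij_is_surj[OF bij_frame_op]])

text \<open>
  The frame operator \<open>S\<close> is self-adjoint, so \<open>\<langle>x, S\<^sup>-\<^sup>1 \<psi>\<^sub>i\<rangle> = \<langle>S\<^sup>-\<^sup>1 x, \<psi>\<^sub>i\<rangle>\<close>: expanding \<open>S (S\<^sup>-\<^sup>1 x) = x\<close> in the
  frame yields the reconstruction formula.
\<close>

lemma cinner_dual_frame: "cinner x (dual_frame \<Psi> i) = cinner (inv (frame_op \<Psi>) x) (\<Psi> i)"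
  using frame_op_self_adjoint[of "inv (frame_op \<Psi>) x" "inv (frame_op \<Psi>) (\<Psi> i)"]
  by (simp add: frame_op_inv dual_frame_def)

lemma dual_frame_reconstruction: "((\<lambda>i. cinner x (dual_frame \<Psi> i) *\<^sub>C \<Psi> i) has_sum x) UNIV"
  using frame_op_has_sum[of "inv (frame_op \<Psi>) x"]
  by (simp add: cinner_dual_frame frame_op_inv)

lemma dual_frame_cinner_has_sum:
  "((\<lambda>i. cinner x (dual_frame \<Psi> i) * cinner (\<Psi> i) y) has_sum cinner x y) UNIV"
  using has_sum_bounded_linear[OF bounded_linear_cinner_left dual_frame_reconstruction, of x y]
  by (simp add: cinner_scaleC_left)

lemma bounded_clinear_eq_on_frame:
  fixes T U :: "'a \<Rightarrow> 'b::complex_hilbert_space"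
  assumes "bounded_clinear T" "bounded_clinear U" "\<And>i. T (\<Psi> i) = U (\<Psi> i)"
  shows "T x = U x"
proof -
  have "((\<lambda>i. V (cinner x (dual_frame \<Psi> i) *\<^sub>C \<Psi> i)) has_sum V x) UNIV" 
    if "bounded_clinear V" for V :: "'a \<Rightarrow> 'b"
    by (rule has_sum_bounded_linear[OF _ dual_frame_reconstruction]) (use that in \<open>simp add: bounded_clinear_def\<close>)
  from this[OF assms(1)] this[OF assms(2)] show ?thesis
    unfolding bounded_clinear_scaleC[OF assms(1)] bounded_clinear_scaleC[OF assms(2)] assms(3)
    by (rule has_sum_unique)
qed

end

section \<open>Mixed-norm bounds on finite sections\<close>

lemma epowr_mono: "x \<le> y \<Longrightarrow> 0 \<le> r \<Longrightarrow> epowr x r \<le> epowr y r"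
  by (auto simp: epowr_def top_unique less_top intro!: ennreal_leI powr_mono2 enn2real_mono)

lemma epowr_ennreal: "0 \<le> t \<Longrightarrow> epowr (ennreal t) r = ennreal (t powr r)"
  by (simp add: epowr_def)

lemma epowr_less_oneD:
  assumes "epowr x r < 1" "0 < r"
  shows "x < 1"
proof (cases x)
  case (real t)
  then have "t powr r < 1"
    using assms(1) by (simp add: epowr_ennreal)
  then have "t < 1"
    using ge_one_powr_ge_zero[of t r] assms(2) by linarith
  then show ?thesis
    using real by simp
next
  case top
  then show ?thesis
    using assms(1) by (simp add: epowr_def)
qed

lemma sum_le_infsum_ennreal: "finite F \<Longrightarrow> sum f F \<le> (infsum f UNIV :: ennreal)"
  by (subst nonneg_infsum_complete) (auto intro: SUP_upper)

text \<open>
  The unit ball of \<open>\<ell>\<^sup>2\<^sup>,\<^sup>p\<close>, tested on finite sections: in this form it is visibly closed under entrywise limits,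
  which is the Fatou property of the norm.
\<close>

definition l2p_unit_ball :: "real \<Rightarrow> ('i \<Rightarrow> 'j \<Rightarrow> complex) set"
  where "l2p_unit_ball p = {d. \<forall>A B. finite A \<longrightarrow> finite B \<longrightarrow>
    (\<Sum>i\<in>A. (\<Sum>j\<in>B. (cmod (d i j))\<^sup>2) powr (p / 2)) \<le> 1}"

lemma l2p_unit_ballD:
  "d \<in> l2p_unit_ball p \<Longrightarrow> finite A \<Longrightarrow> finite B \<Longrightarrow>
    (\<Sum>i\<in>A. (\<Sum>j\<in>B. (cmod (d i j))\<^sup>2) powr (p / 2)) \<le> 1"
  by (simp add: l2p_unit_ball_def)

lemma l2p_norm_less_one_imp_unit_ball:
  fixes c :: "'i \<Rightarrow> 'j \<Rightarrow> complex"
  assumes "l2p_norm p c < 1" "1 \<le> p"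
  shows "c \<in> l2p_unit_ball p"
  unfolding l2p_unit_ball_def
proof (intro CollectI allI impI)
  fix A :: "'i set" and B :: "'j set" assume AB: "finite A" "finite B"
  define R where "R i = (\<Sum>\<^sub>\<infinity>j. ennreal ((cmod (c i j))\<^sup>2))" for i
  have "(\<Sum>\<^sub>\<infinity>i. epowr (R i) (p / 2)) < 1"
    using assms by (intro epowr_less_oneD[of _ "1 / p", OF assms(1)[unfolded l2p_norm_def, folded R_def]]) simp
  have "ennreal (\<Sum>i\<in>A. (\<Sum>j\<in>B. (cmod (c i j))\<^sup>2) powr (p / 2))
      = (\<Sum>i\<in>A. epowr (\<Sum>j\<in>B. ennreal ((cmod (c i j))\<^sup>2)) (p / 2))"
    by (simp add: sum_nonneg epowr_ennreal)
  also have "\<dots> \<le> (\<Sum>i\<in>A. epowr (R i) (p / 2))"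
    unfolding R_def using AB assms(2) by (intro sum_mono epowr_mono sum_le_infsum_ennreal) auto
  also have "\<dots> \<le> (\<Sum>\<^sub>\<infinity>i. epowr (R i) (p / 2))"
    using AB by (intro sum_le_infsum_ennreal)
  also have "\<dots> < 1" by fact
  finally show "(\<Sum>i\<in>A. (\<Sum>j\<in>B. (cmod (c i j))\<^sup>2) powr (p / 2)) \<le> 1"
    by (simp add: ennreal_less_one_iff)
qed

lemma powr_sum_le_sum_powr:
  fixes a :: "'k \<Rightarrow> real"
  assumes "0 < q" "q \<le> 1" "\<And>i. i \<in> B \<Longrightarrow> 0 \<le> a i"
  shows "(\<Sum>i\<in>B. a i) powr q \<le> (\<Sum>i\<in>B. a i powr q)"
proof (cases "(\<Sum>i\<in>B. a i) = 0")
  case True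
  then show ?thesis by (simp add: sum_nonneg)
next
  case False
  define s where "s = (\<Sum>i\<in>B. a i)"
  have s: "s > 0"
    using False sum_nonneg[of B a] assms(3) by (simp add: s_def order_less_le)
  have fin: "finite B"
    using False by (rule contrapos_np) simp
  have "s powr q = (\<Sum>i\<in>B. s powr q * (a i / s))"
    using s by (simp add: s_def sum_distrib_left[symmetric] sum_divide_distrib[symmetric])
  also have "\<dots> \<le> (\<Sum>i\<in>B. a i powr q)"
  proof (rule sum_mono)
    fix i assume i: "i \<in> B"
    have "a i \<le> s"
      unfolding s_def using fin i assms(3) by (intro member_le_sum) auto
    then have le: "a i / s \<le> 1" "0 \<le> a i / s"
      using s assms(3)[OF i] by auto
    then have "(a i / s) powr 1 \<le> (a i / s) powr q"
      using assms(2) by (intro powr_mono') auto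
    then have "s powr q * (a i / s) \<le> s powr q * (a i / s) powr q"
      unfolding powr_one[OF le(2)] by (rule mult_left_mono) simp
    also have "\<dots> = a i powr q"
      using s assms(3)[OF i] by (simp add: powr_divide)
    finally show "s powr q * (a i / s) \<le> a i powr q" .
  qed
  finally show ?thesis by (simp add: s_def)
qed

text \<open>For \<open>p \<le> 2\<close> the \<open>\<ell>\<^sup>2\<close> norm of a row is dominated by its \<open>\<ell>\<^sup>p\<close> norm.\<close>

lemma lpp_norm_less_one_imp_unit_ball:
  fixes c :: "'i \<Rightarrow> 'j \<Rightarrow> complex"
  assumes "lpp_norm p c < 1" "1 \<le> p" "p \<le> 2"
  shows "c \<in> l2p_unit_ball p"
  unfolding l2p_unit_ball_def
proof (intro CollectI allI impI)
  fix A :: "'i set" and B :: "'j set" assume AB: "finite A" "finite B"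
  have "(\<Sum>\<^sub>\<infinity>ij. ennreal (cmod (case ij of (i, j) \<Rightarrow> c i j) powr p)) < 1"
    using assms by (intro epowr_less_oneD[of _ "1 / p", OF assms(1)[unfolded lpp_norm_def lp_norm_def]]) simp
  moreover have "ennreal (\<Sum>ij\<in>A \<times> B. cmod (case ij of (i, j) \<Rightarrow> c i j) powr p)
      \<le> (\<Sum>\<^sub>\<infinity>ij. ennreal (cmod (case ij of (i, j) \<Rightarrow> c i j) powr p))"
    unfolding sum_ennreal[OF powr_ge_zero, symmetric] using AB by (intro sum_le_infsum_ennreal) simp
  ultimately have "ennreal (\<Sum>ij\<in>A \<times> B. cmod (case ij of (i, j) \<Rightarrow> c i j) powr p) < 1"
    using order.strict_trans1 by blast
  then have le: "(\<Sum>i\<in>A. \<Sum>j\<in>B. cmod (c i j) powr p) \<le> 1"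
    by (simp add: ennreal_less_one_iff sum.cartesian_product case_prod_unfold)
  have "((cmod z)\<^sup>2) powr (p / 2) = cmod z powr p" for z
  proof (cases "z = 0")
    case False
    then have "(cmod z)\<^sup>2 = cmod z powr 2" by simp
    then show ?thesis by (simp only: powr_powr) simp
  qed simp
  then have "(\<Sum>i\<in>A. (\<Sum>j\<in>B. (cmod (c i j))\<^sup>2) powr (p / 2)) \<le> (\<Sum>i\<in>A. \<Sum>j\<in>B. cmod (c i j) powr p)"
    using assms by (intro sum_mono order_trans[OF powr_sum_le_sum_powr]) auto
  with le show "(\<Sum>i\<in>A. (\<Sum>j\<in>B. (cmod (c i j))\<^sup>2) powr (p / 2)) \<le> 1"
    by linarith
qed

lemma l2p_unit_ball_limit:
  fixes d :: "'i \<Rightarrow> 'j \<Rightarrow> complex"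
  assumes "\<And>n. X n \<in> l2p_unit_ball p" "\<And>i j. (\<lambda>n. X n i j) \<longlonglongrightarrow> d i j" "0 < p"
  shows "d \<in> l2p_unit_ball p"
  unfolding l2p_unit_ball_def
proof (intro CollectI allI impI)
  fix A :: "'i set" and B :: "'j set" assume AB: "finite A" "finite B"
  have "(\<lambda>n. (\<Sum>i\<in>A. (\<Sum>j\<in>B. (cmod (X n i j))\<^sup>2) powr (p / 2))) \<longlonglongrightarrow>
      (\<Sum>i\<in>A. (\<Sum>j\<in>B. (cmod (d i j))\<^sup>2) powr (p / 2))"
    using assms(3)
    by (intro tendsto_sum tendsto_powr' tendsto_power tendsto_norm assms(2) tendsto_const)
       (auto intro!: always_eventually sum_nonneg)
  then show "(\<Sum>i\<in>A. (\<Sum>j\<in>B. (cmod (d i j))\<^sup>2) powr (p / 2)) \<le> 1"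
    by (rule LIMSEQ_le_const2) (use AB l2p_unit_ballD[OF assms(1)] in blast)
qed

lemma l2p_unit_ball_row:
  fixes d :: "'i \<Rightarrow> 'j \<Rightarrow> complex"
  assumes d: "d \<in> l2p_unit_ball p" and p: "0 < p"
  shows l2p_unit_ball_row_summable: "(\<lambda>j. (cmod (d i j))\<^sup>2) summable_on UNIV"
    and l2p_unit_ball_row_le_one: "(\<Sum>\<^sub>\<infinity>j. (cmod (d i j))\<^sup>2) \<le> 1"
proof -
  have le: "(\<Sum>j\<in>B. (cmod (d i j))\<^sup>2) \<le> 1" if "finite B" for B :: "'j set"
  proof (rule ccontr)
    assume "\<not> ?thesis"
    then have "1 < (\<Sum>j\<in>B. (cmod (d i j))\<^sup>2) powr (p / 2)"
      using p by (intro gr_one_powr) auto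
    then show False
      using l2p_unit_ballD[OF d, of "{i}" B] that by simp
  qed
  show "(\<lambda>j. (cmod (d i j))\<^sup>2) summable_on UNIV" and "(\<Sum>\<^sub>\<infinity>j. (cmod (d i j))\<^sup>2) \<le> 1"
    using le by (auto intro!: nonneg_summable_on_boundedI)
qed

lemma l2p_unit_ball_rows_powr_summable:
  fixes d :: "'i \<Rightarrow> 'j \<Rightarrow> complex"
  assumes d: "d \<in> l2p_unit_ball p" and p: "0 < p"
  shows "(\<lambda>i. (\<Sum>\<^sub>\<infinity>j. (cmod (d i j))\<^sup>2) powr (p / 2)) summable_on UNIV"
proof (rule nonneg_summable_on_boundedI(1))
  fix A :: "'i set" assume A: "finite A"
  show "(\<Sum>i\<in>A. (\<Sum>\<^sub>\<infinity>j. (cmod (d i j))\<^sup>2) powr (p / 2)) \<le> 1"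
  proof (rule tendsto_upperbound)
    have "((\<lambda>B. \<Sum>j\<in>B. (cmod (d i j))\<^sup>2) \<longlongrightarrow> (\<Sum>\<^sub>\<infinity>j. (cmod (d i j))\<^sup>2)) (finite_subsets_at_top UNIV)" for i
      using has_sum_infsum[OF l2p_unit_ball_row_summable[OF d p]] unfolding has_sum_def .
    then show "((\<lambda>B. \<Sum>i\<in>A. (\<Sum>j\<in>B. (cmod (d i j))\<^sup>2) powr (p / 2)) \<longlongrightarrow>
        (\<Sum>i\<in>A. (\<Sum>\<^sub>\<infinity>j. (cmod (d i j))\<^sup>2) powr (p / 2))) (finite_subsets_at_top UNIV)"
      using p by (intro tendsto_sum tendsto_powr' tendsto_const) (auto intro!: always_eventually sum_nonneg)
    show "\<forall>\<^sub>F B in finite_subsets_at_top UNIV. (\<Sum>i\<in>A. (\<Sum>j\<in>B. (cmod (d i j))\<^sup>2) powr (p / 2)) \<le> 1"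
      by (rule eventually_finite_subsets_at_top_weakI) (rule l2p_unit_ballD[OF d A])
  qed simp
qed simp

lemma l2p_unit_ball_square_summable:
  assumes d: "d \<in> l2p_unit_ball p" and p: "0 < p" "p \<le> 2"
  shows "(\<lambda>(i, j). (cmod (d i j))\<^sup>2) summable_on UNIV"
proof -
  have "(\<lambda>i. \<Sum>\<^sub>\<infinity>j. (cmod (d i j))\<^sup>2) summable_on UNIV"
  proof (rule summable_on_comparison_test[OF l2p_unit_ball_rows_powr_summable[OF d p(1)]])
    fix i
    show "0 \<le> (\<Sum>\<^sub>\<infinity>j. (cmod (d i j))\<^sup>2)" by (simp add: infsum_nonneg)
    then have "(\<Sum>\<^sub>\<infinity>j. (cmod (d i j))\<^sup>2) powr 1 \<le> (\<Sum>\<^sub>\<infinity>j. (cmod (d i j))\<^sup>2) powr (p / 2)"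
      using l2p_unit_ball_row_le_one[OF d p(1)] p by (intro powr_mono') auto
    then show "(\<Sum>\<^sub>\<infinity>j. (cmod (d i j))\<^sup>2) \<le> (\<Sum>\<^sub>\<infinity>j. (cmod (d i j))\<^sup>2) powr (p / 2)"
      using \<open>0 \<le> (\<Sum>\<^sub>\<infinity>j. (cmod (d i j))\<^sup>2)\<close> by simp
  qed
  then have "(\<lambda>(i, j). (cmod (d i j))\<^sup>2) summable_on (UNIV \<times> UNIV)"
    by (rule summable_on_SigmaI[rotated])
       (use has_sum_infsum[OF l2p_unit_ball_row_summable[OF d p(1)]] in auto)
  then show ?thesis by simp
qed

section \<open>Finite-rank operators and their coefficients\<close>

lemma sum_of_tensors_Nil: "sum_of_tensors [] = 0"
  by (simp add: sum_of_tensors_def)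

lemma sum_of_tensors_Cons: "sum_of_tensors ((f1, f2) # xs) = f1 \<otimes>\<^sub>t f2 + sum_of_tensors xs"
  by (simp add: sum_of_tensors_def)

lemma sum_of_tensors_apply:
  "sum_of_tensors xs x = (\<Sum>l<length xs. cinner x (fst (xs ! l)) *\<^sub>C snd (xs ! l))"
proof (induction xs)
  case (Cons y ys)
  then show ?case
    by (cases y) (simp add: sum_of_tensors_Cons simple_tensor_def sum.lessThan_Suc_shift del: sum.lessThan_Suc)
qed (simp add: sum_of_tensors_Nil)

lemma bounded_clinear_sum_of_tensors:
  fixes xs :: "('a::complex_hilbert_space \<times> 'b::complex_hilbert_space) list"
  shows "bounded_clinear (sum_of_tensors xs)"
  unfolding bounded_clinear_def sum_of_tensors_apply[abs_def]
proof (intro conjI allI)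
  show "bounded_linear (\<lambda>x. \<Sum>l<length xs. cinner x (fst (xs ! l)) *\<^sub>C snd (xs ! l))"
    by (intro bounded_linear_sum bounded_linear_compose[OF bounded_linear_scaleC_left bounded_linear_cinner_left])
qed (simp add: cinner_scaleC_left complex_vector.scale_sum_right scaleC_scaleC)

lemma H00_sum_of_tensors:
  fixes \<Psi>1 :: "'i \<Rightarrow> 'a::complex_hilbert_space" and \<Psi>2 :: "'j \<Rightarrow> 'b::complex_hilbert_space"
  assumes "F \<in> H00 \<Psi>1 \<Psi>2"
  obtains xs where "F = sum_of_tensors xs"
proof -
  have "\<exists>xs. F = sum_of_tensors xs"
    using assms unfolding H00_def
  proof (induction rule: complex_vector.span_induct_alt)
    case base
    show ?case by (metis sum_of_tensors_Nil)
  next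
    case (step c x y)
    then obtain i j ys where "x = \<Psi>1 i \<otimes>\<^sub>t \<Psi>2 j" "y = sum_of_tensors ys" by blast
    then have "c *\<^sub>C x + y = sum_of_tensors ((\<Psi>1 i, c *\<^sub>C \<Psi>2 j) # ys)"
      by (simp add: sum_of_tensors_Cons simple_tensor_def scaleC_fun_def fun_eq_iff scaleC_scaleC mult.commute)
    then show ?case by blast
  qed
  then show thesis using that by blast
qed

lemma tensor_inner_simple_tensor:
  "tensor_inner (sum_of_tensors xs) (g1 \<otimes>\<^sub>t g2) = cinner (sum_of_tensors xs g1) g2"
proof -
  have "g1 \<otimes>\<^sub>t g2 = sum_of_tensors [(g1, g2)]"
    by (simp add: sum_of_tensors_Cons sum_of_tensors_Nil)
  then show ?thesis
    by (simp only: tensor_inner_sum_of_tensors tensor_sum_left) simp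
qed

lemma tensor_inner_simple_tensors:
  "tensor_inner (f1 \<otimes>\<^sub>t f2) (g1 \<otimes>\<^sub>t g2) = cinner g1 f1 * cinner f2 g2"
  using tensor_inner_simple_tensor[of "[(f1, f2)]" g1 g2]
  by (simp add: sum_of_tensors_Cons sum_of_tensors_Nil simple_tensor_def cinner_scaleC_left)

lemma alg_coeff_H00:
  assumes "F \<in> H00 \<Psi>1 \<Psi>2"
  shows "alg_coeff \<Psi>1 \<Psi>2 F i j = cinner (F (dual_frame \<Psi>1 i)) (dual_frame \<Psi>2 j)"
  by (rule H00_sum_of_tensors[OF assms]) (simp add: alg_coeff_def tensor_inner_simple_tensor)

lemma alg_coeff_diff:
  assumes "F \<in> H00 \<Psi>1 \<Psi>2" "G \<in> H00 \<Psi>1 \<Psi>2"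
  shows "alg_coeff \<Psi>1 \<Psi>2 (F - G) i j = alg_coeff \<Psi>1 \<Psi>2 F i j - alg_coeff \<Psi>1 \<Psi>2 G i j"
proof -
  have "F - G \<in> H00 \<Psi>1 \<Psi>2"
    using assms unfolding H00_def by (rule complex_vector.span_diff)
  then show ?thesis
    by (simp add: assms alg_coeff_H00 cinner_diff_left)
qed

text \<open>
  A Cauchy sequence that represents \<open>K\<close> eventually stays within distance \<open>1\<close> of one of its members \<open>F\<^sub>M\<close>. Hence the
  coefficients of \<open>K\<close> differ from those of the finite-rank operator \<open>G = F\<^sub>M\<close> by an entrywise limit of arrays
  \<open>X\<^sub>n\<close> from the unit ball of the sequence space.
\<close>

lemma coorbit_completion_near_H00:
  fixes \<Psi>1 :: "'i \<Rightarrow> 'a::complex_hilbert_space" and \<Psi>2 :: "'j \<Rightarrow> 'b::complex_hilbert_space"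
  assumes "K \<in> coorbit_completion nrm \<Psi>1 \<Psi>2"
  obtains G X where "G \<in> H00 \<Psi>1 \<Psi>2" "\<And>n. nrm (X n) < 1"
    "\<And>i j. (\<lambda>n::nat. X n i j) \<longlonglongrightarrow> Hinf_coeff \<Psi>1 \<Psi>2 K i j - alg_coeff \<Psi>1 \<Psi>2 G i j"
proof -
  define N where "N = (\<lambda>F. nrm (alg_coeff \<Psi>1 \<Psi>2 F))"
  obtain Y F where "Y \<in> completion (H00 \<Psi>1 \<Psi>2) N" "F \<in> Y"
    and lim: "\<And>i j. (\<lambda>n. alg_coeff \<Psi>1 \<Psi>2 (F n) i j) \<longlonglongrightarrow> Hinf_coeff \<Psi>1 \<Psi>2 K i j"
    using assms unfolding coorbit_completion_def N_def by blast
  then have "F \<in> cauchy_seqs (H00 \<Psi>1 \<Psi>2) N"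
    unfolding completion_def quotient_def null_equiv_def by blast
  then have F: "\<And>n. F n \<in> H00 \<Psi>1 \<Psi>2"
    and cauchy: "\<forall>\<epsilon>>0. \<exists>M. \<forall>m\<ge>M. \<forall>n\<ge>M. N (F m - F n) < \<epsilon>"
    by (auto simp: cauchy_seqs_def)
  obtain M where M: "\<And>m n. m \<ge> M \<Longrightarrow> n \<ge> M \<Longrightarrow> N (F m - F n) < 1"
    using cauchy zero_less_one by blast
  show thesis
  proof (rule that[of "F M" "\<lambda>n. alg_coeff \<Psi>1 \<Psi>2 (F (n + M) - F M)"])
    show "nrm (alg_coeff \<Psi>1 \<Psi>2 (F (n + M) - F M)) < 1" for n
      using M[of "n + M" M] by (simp add: N_def)
    show "(\<lambda>n. alg_coeff \<Psi>1 \<Psi>2 (F (n + M) - F M) i j) \<longlonglongrightarrow>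
        Hinf_coeff \<Psi>1 \<Psi>2 K i j - alg_coeff \<Psi>1 \<Psi>2 (F M) i j" for i j
      unfolding alg_coeff_diff[OF F F]
      by (intro tendsto_diff tendsto_const LIMSEQ_ignore_initial_segment lim)
  qed (rule F)
qed

section \<open>From the kernel to the operator\<close>

lemma has_sum_finite_sum:
  fixes f :: "'l \<Rightarrow> 'k \<Rightarrow> 'c::topological_comm_monoid_add"
  assumes "\<And>l. l \<in> L \<Longrightarrow> (f l has_sum S l) A"
  shows "((\<lambda>k. \<Sum>l\<in>L. f l k) has_sum (\<Sum>l\<in>L. S l)) A"
  using assms by (induction L rule: infinite_finite_induct) (simp_all add: has_sum_add)

lemma has_sum_product:
  fixes f :: "'k \<Rightarrow> complex" and g :: "'l \<Rightarrow> complex"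
  assumes f: "(f has_sum a) UNIV" and g: "(g has_sum b) UNIV"
  shows "((\<lambda>(i, j). f i * g j) has_sum a * b) UNIV"
proof -
  have "(\<lambda>i. norm (f i)) summable_on UNIV" and ng: "(\<lambda>j. norm (g j)) summable_on UNIV"
    using f g has_sum_imp_summable summable_on_iff_abs_summable_on_complex by blast+
  then have "(\<lambda>i. norm (f i) * (\<Sum>\<^sub>\<infinity>j. norm (g j))) summable_on UNIV"
    by (intro summable_on_cmult_left)
  then have "(\<lambda>(i, j). norm (f i) * norm (g j)) summable_on (UNIV \<times> UNIV)"
    by (rule summable_on_SigmaI[rotated]) (use has_sum_cmult_right[OF has_sum_infsum[OF ng]] in auto)
  then have "(\<lambda>(i, j). f i * g j) summable_on (UNIV \<times> UNIV)"
    using abs_summable_summable[of "\<lambda>(i, j). f i * g j"] by (simp add: case_prod_unfold norm_mult)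
  then have "((\<lambda>(i, j). f i * g j) has_sum a * b) (UNIV \<times> UNIV)"
    by (intro has_sum_SigmaI[where g = "\<lambda>i. f i * b"])
       (use has_sum_cmult_right[OF g] has_sum_cmult_left[OF f] in auto)
  then show ?thesis by simp
qed

text \<open>
  The kernel formula for finite-rank operators: both frames reproduce, so the coefficients with respect to
  the dual frames return the sesquilinear form of the operator.
\<close>

lemma sum_of_tensors_kernel_has_sum:
  fixes \<Psi>1 :: "'i::countable \<Rightarrow> 'a::complex_hilbert_space" and \<Psi>2 :: "'j::countable \<Rightarrow> 'b::complex_hilbert_space"
  assumes "frame \<Psi>1" "frame \<Psi>2"
  shows "((\<lambda>(i, j). cinner (sum_of_tensors xs (dual_frame \<Psi>1 i)) (dual_frame \<Psi>2 j) *
      (cinner x (\<Psi>1 i) * cinner (\<Psi>2 j) y)) has_sum cinner (sum_of_tensors xs x) y) UNIV"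
proof -
  interpret f1: frame \<Psi>1 by fact
  interpret f2: frame \<Psi>2 by fact
  have rank_one: "((\<lambda>(i, j). cinner (dual_frame \<Psi>1 i) f1 * cinner f2 (dual_frame \<Psi>2 j) *
      (cinner x (\<Psi>1 i) * cinner (\<Psi>2 j) y)) has_sum cinner x f1 * cinner f2 y) UNIV" for f1 f2
  proof -
    have "((\<lambda>i. cnj (cinner f1 (dual_frame \<Psi>1 i) * cinner (\<Psi>1 i) x)) has_sum cnj (cinner f1 x)) UNIV"
      using f1.dual_frame_cinner_has_sum by (simp only: has_sum_cnj_iff)
    then have "((\<lambda>i. cinner (dual_frame \<Psi>1 i) f1 * cinner x (\<Psi>1 i)) has_sum cinner x f1) UNIV"
      by (simp add: cinner_commute[of f1] cinner_commute[of _ x])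
    from has_sum_product[OF this f2.dual_frame_cinner_has_sum[of f2 y]] show ?thesis
      by (simp add: mult_ac)
  qed
  have "((\<lambda>ij. \<Sum>l<length xs. case ij of (i, j) \<Rightarrow>
      cinner (dual_frame \<Psi>1 i) (fst (xs ! l)) * cinner (snd (xs ! l)) (dual_frame \<Psi>2 j) *
      (cinner x (\<Psi>1 i) * cinner (\<Psi>2 j) y)) has_sum
      (\<Sum>l<length xs. cinner x (fst (xs ! l)) * cinner (snd (xs ! l)) y)) UNIV"
    by (intro has_sum_finite_sum rank_one)
  then show ?thesis
    by (simp add: sum_of_tensors_apply cinner_sum_left cinner_scaleC_left sum_distrib_right case_prod_unfold)
qed

text \<open>
  The kernel formula for the operator whose coefficient matrix \<open>d\<close> is square summable: the double series converges
  absolutely by \<open>2 \<bar>d a b\<bar> \<le> \<bar>d\<bar>\<^sup>2 + \<bar>a\<bar>\<^sup>2 \<bar>b\<bar>\<^sup>2\<close>, so it may be summed row by row.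
\<close>

lemma square_summable_kernel_has_sum:
  fixes u :: "'i \<Rightarrow> 'a::complex_hilbert_space" and v :: "'j \<Rightarrow> 'b::complex_hilbert_space"
  assumes u: "bessel_family UNIV u B" and v: "bessel_family UNIV v C"
    and d: "(\<lambda>(i, j). (cmod (d i j))\<^sup>2) summable_on UNIV"
    and h: "\<And>i. ((\<lambda>j. d i j *\<^sub>C v j) has_sum h i) UNIV"
    and U: "((\<lambda>i. cinner x (u i) *\<^sub>C h i) has_sum z) UNIV"
  shows "((\<lambda>(i, j). d i j * (cinner x (u i) * cinner (v j) y)) has_sum cinner z y) UNIV"
proof -
  define a where "a i = cinner x (u i)" for i
  define b where "b j = cinner (v j) y" for j
  have row: "((\<lambda>j. d i j * (a i * b j)) has_sum a i * cinner (h i) y) UNIV" for i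
    using has_sum_cmult_right[OF has_sum_bounded_linear[OF bounded_linear_cinner_left[of y] h[of i]], of "a i"]
    by (simp add: cinner_scaleC_left b_def mult_ac)
  have col: "((\<lambda>i. a i * cinner (h i) y) has_sum cinner z y) UNIV"
    using has_sum_bounded_linear[OF bounded_linear_cinner_left[of y] U] by (simp add: cinner_scaleC_left a_def)
  have cmod_b: "cmod (b j) = cmod (cinner y (v j))" for j
    unfolding b_def by (metis cinner_commute complex_mod_cnj)
  have a2: "(\<lambda>i. (cmod (a i))\<^sup>2) summable_on UNIV" and b2: "(\<lambda>j. (cmod (b j))\<^sup>2) summable_on UNIV"
    unfolding cmod_b a_def using bessel_family_bound[OF u] bessel_family_bound[OF v]
    by (auto intro!: nonneg_summable_on_boundedI(1))
  have "(\<lambda>i. (cmod (a i))\<^sup>2 * (\<Sum>\<^sub>\<infinity>j. (cmod (b j))\<^sup>2)) summable_on UNIV"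
    using a2 by (rule summable_on_cmult_left)
  then have "(\<lambda>(i, j). (cmod (a i))\<^sup>2 * (cmod (b j))\<^sup>2) summable_on (UNIV \<times> UNIV)"
    by (rule summable_on_SigmaI[rotated]) (use has_sum_cmult_right[OF has_sum_infsum[OF b2]] in auto)
  then have "(\<lambda>ij. (case ij of (i, j) \<Rightarrow> (cmod (d i j))\<^sup>2) + (case ij of (i, j) \<Rightarrow> (cmod (a i))\<^sup>2 * (cmod (b j))\<^sup>2))
      summable_on UNIV"
    by (intro summable_on_add d) simp
  then have "(\<lambda>ij. norm (case ij of (i, j) \<Rightarrow> d i j * (a i * b j))) summable_on UNIV"
  proof (rule summable_on_comparison_test)
    fix ij :: "'i \<times> 'j"
    obtain i j where ij: "ij = (i, j)" by fastforce
    have "2 * cmod (d i j) * (cmod (a i) * cmod (b j)) \<le> (cmod (d i j))\<^sup>2 + (cmod (a i) * cmod (b j))\<^sup>2"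
      by (rule sum_squares_bound)
    moreover have "0 \<le> cmod (d i j) * (cmod (a i) * cmod (b j))" by simp
    ultimately have "cmod (d i j) * (cmod (a i) * cmod (b j)) \<le> (cmod (d i j))\<^sup>2 + (cmod (a i) * cmod (b j))\<^sup>2"
      by linarith
    then show "norm (case ij of (i, j) \<Rightarrow> d i j * (a i * b j)) \<le>
        (case ij of (i, j) \<Rightarrow> (cmod (d i j))\<^sup>2) + (case ij of (i, j) \<Rightarrow> (cmod (a i))\<^sup>2 * (cmod (b j))\<^sup>2)"
      by (simp add: ij norm_mult power_mult_distrib)
  qed simp
  then have "(\<lambda>(i, j). d i j * (a i * b j)) summable_on (UNIV \<times> UNIV)"
    using abs_summable_summable by auto
  then have "((\<lambda>(i, j). d i j * (a i * b j)) has_sum cinner z y) (UNIV \<times> UNIV)"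
    by (intro has_sum_SigmaI[OF _ col]) (use row in auto)
  then show ?thesis
    by (simp add: a_def b_def)
qed

text \<open>The frame elements lie in \<^const>\<open>H1\<close> as limits of constant sequences.\<close>

lemma frame_element_in_H1: "\<Psi> i \<in> H1 \<Psi>"
proof -
  define V where "V = cspan (range \<Psi>)"
  define N where "N = (\<lambda>f. lp_norm 1 (analysis_op (dual_frame \<Psi>) f))"
  define F where "F = (\<lambda>n::nat. \<Psi> i)"
  have "N 0 = 0"
    by (simp add: N_def lp_norm_def analysis_op_def cinner_zero_left epowr_def)
  then have "F \<in> cauchy_seqs V N"
    by (auto simp: cauchy_seqs_def F_def V_def complex_vector.span_base)
  moreover from this have "F \<in> null_equiv V N `` {F}"
    using \<open>N 0 = 0\<close> by (simp add: null_equiv_def F_def)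
  ultimately have "\<exists>X\<in>completion V N. F \<in> X"
    unfolding completion_def by (blast intro: quotientI)
  moreover have "F \<longlonglongrightarrow> \<Psi> i"
    by (simp add: F_def)
  ultimately show ?thesis
    unfolding H1_def V_def N_def by blast
qed

text \<open>
  Write \<open>d\<close> for the difference of the coefficients of \<open>K\<close> and \<open>G\<close>, and \<open>h\<^sub>i = \<Sum>\<^sub>j d\<^sub>i\<^sub>j \<psi>\<^sub>2\<^sub>,\<^sub>j\<close>. The kernel formula shows that
  \<open>T\<close> and \<open>x \<mapsto> G x + \<Sum>\<^sub>i \<langle>x, \<psi>\<^sub>1\<^sub>,\<^sub>i\<rangle> h\<^sub>i\<close> have the same matrix elements between frame vectors, so they are equal, and
  \<open>\<parallel>h\<^sub>i\<parallel>\<close> is at most a constant times the \<open>\<ell>\<^sup>2\<close> norm of the \<open>i\<close>-th row of \<open>d\<close>. Appending the finitely many rank-one terms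
  of \<open>G\<close> to the family \<open>\<Psi>\<^sub>1\<close> leaves it a Bessel family, which puts \<open>T\<close> in the form required by the Schatten class criterion.
\<close>

lemma kernel_near_finite_rank_imp_schatten:
  fixes \<Psi>1 :: "'i::countable \<Rightarrow> 'a::complex_hilbert_space"
    and \<Psi>2 :: "'j::countable \<Rightarrow> 'b::complex_hilbert_space"
  assumes fr: "frame \<Psi>1" "frame \<Psi>2" and p: "1 \<le> p" "p \<le> 2" and T: "bounded_clinear T"
    and kernel: "is_kernel \<Psi>1 \<Psi>2 T K" and G: "G \<in> H00 \<Psi>1 \<Psi>2"
    and ball: "(\<lambda>i j. Hinf_coeff \<Psi>1 \<Psi>2 K i j - alg_coeff \<Psi>1 \<Psi>2 G i j) \<in> l2p_unit_ball p"
  shows "T \<in> schatten_class p"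
proof -
  interpret f1: frame \<Psi>1 by fact
  interpret f2: frame \<Psi>2 by fact
  obtain B where u: "bessel_family UNIV \<Psi>1 B" by (rule f1.frame_bounds)
  obtain C where v: "bessel_family UNIV \<Psi>2 C" by (rule f2.frame_bounds)
  define d where "d = (\<lambda>i j. Hinf_coeff \<Psi>1 \<Psi>2 K i j - alg_coeff \<Psi>1 \<Psi>2 G i j)"
  have d: "d \<in> l2p_unit_ball p"
    using ball by (simp add: d_def)
  have p0: "0 < p" using p by simp
  obtain xs where xs: "G = sum_of_tensors xs"
    using G by (rule H00_sum_of_tensors)
  define R where "R i = (\<Sum>\<^sub>\<infinity>j. (cmod (d i j))\<^sup>2)" for i
  define h where "h i = (\<Sum>\<^sub>\<infinity>j. d i j *\<^sub>C \<Psi>2 j)" for i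
  have h: "((\<lambda>j. d i j *\<^sub>C \<Psi>2 j) has_sum h i) UNIV" for i
    unfolding h_def
    by (rule has_sum_infsum[OF bessel_synthesis_summable[OF v l2p_unit_ball_row_summable[OF d p0]]])
  have h_powr: "(\<lambda>i. norm (h i) powr p) summable_on UNIV"
  proof (rule summable_on_comparison_test)
    show "(\<lambda>i. sqrt C powr p * R i powr (p / 2)) summable_on UNIV"
      unfolding R_def by (intro summable_on_cmult_right l2p_unit_ball_rows_powr_summable[OF d p0])
    fix i
    have "R i \<ge> 0" by (simp add: R_def infsum_nonneg)
    have "norm (h i) powr p \<le> (sqrt C * sqrt (R i)) powr p"
      unfolding h_def R_def using p0
      by (intro powr_mono2 norm_bessel_synthesis[OF v l2p_unit_ball_row_summable[OF d p0]]) auto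
    also have "\<dots> = sqrt C powr p * R i powr (p / 2)"
      using bessel_family_pos[OF v] \<open>R i \<ge> 0\<close> by (simp add: powr_mult powr_half_sqrt[symmetric] powr_powr)
    finally show "norm (h i) powr p \<le> sqrt C powr p * R i powr (p / 2)" .
  qed simp
  have h_square: "(\<lambda>i. (norm (h i))\<^sup>2) summable_on UNIV"
    using summable_powr_imp_summable_square[OF p _ h_powr] by simp
  define U where "U x = (\<Sum>\<^sub>\<infinity>i. cinner x (\<Psi>1 i) *\<^sub>C h i)" for x
  have U: "((\<lambda>i. cinner x (\<Psi>1 i) *\<^sub>C h i) has_sum U x) UNIV" for x
    unfolding U_def
    by (rule has_sum_infsum[OF abs_summable_summable[OF bessel_sum_abs_summable[OF u h_square]]])
  have "bounded_clinear U"
    using bounded_clinear_bessel_sum[OF u h_square] unfolding U_def .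
  have matrix: "cinner (T (\<Psi>1 a)) (\<Psi>2 b) = cinner (G (\<Psi>1 a) + U (\<Psi>1 a)) (\<Psi>2 b)" for a b
  proof -
    have "((\<lambda>ij. (case ij of (i, j) \<Rightarrow> cinner (G (dual_frame \<Psi>1 i)) (dual_frame \<Psi>2 j) *
          (cinner (\<Psi>1 a) (\<Psi>1 i) * cinner (\<Psi>2 j) (\<Psi>2 b))) +
        (case ij of (i, j) \<Rightarrow> d i j * (cinner (\<Psi>1 a) (\<Psi>1 i) * cinner (\<Psi>2 j) (\<Psi>2 b)))) has_sum
        cinner (G (\<Psi>1 a)) (\<Psi>2 b) + cinner (U (\<Psi>1 a)) (\<Psi>2 b)) UNIV"
      unfolding xs by (intro has_sum_add sum_of_tensors_kernel_has_sum fr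
        square_summable_kernel_has_sum[OF u v l2p_unit_ball_square_summable[OF d p0 p(2)] h U])
    moreover have "(case ij of (i, j) \<Rightarrow> cinner (G (dual_frame \<Psi>1 i)) (dual_frame \<Psi>2 j) *
          (cinner (\<Psi>1 a) (\<Psi>1 i) * cinner (\<Psi>2 j) (\<Psi>2 b))) +
        (case ij of (i, j) \<Rightarrow> d i j * (cinner (\<Psi>1 a) (\<Psi>1 i) * cinner (\<Psi>2 j) (\<Psi>2 b))) =
      (case ij of (i, j) \<Rightarrow> Hinf_coeff \<Psi>1 \<Psi>2 K i j * cnj (tensor_inner (\<Psi>1 a \<otimes>\<^sub>t \<Psi>2 b) (\<Psi>1 i \<otimes>\<^sub>t \<Psi>2 j)))" for ij
      by (cases ij) (simp add: d_def alg_coeff_H00[OF G] tensor_inner_simple_tensors distrib_right[symmetric]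
          cinner_commute[of "\<Psi>1 a"] cinner_commute[of _ "\<Psi>2 b"])
    ultimately have "kernel_pairing \<Psi>1 \<Psi>2 K (\<Psi>1 a \<otimes>\<^sub>t \<Psi>2 b) = cinner (G (\<Psi>1 a)) (\<Psi>2 b) + cinner (U (\<Psi>1 a)) (\<Psi>2 b)"
      unfolding kernel_pairing_def by (simp add: infsumI)
    moreover have "cinner (T (\<Psi>1 a)) (\<Psi>2 b) = kernel_pairing \<Psi>1 \<Psi>2 K (\<Psi>1 a \<otimes>\<^sub>t \<Psi>2 b)"
      using kernel unfolding is_kernel_def by (simp add: frame_element_in_H1)
    ultimately show ?thesis
      by (simp add: cinner_add_left)
  qed
  have "T (\<Psi>1 a) - (G (\<Psi>1 a) + U (\<Psi>1 a)) = 0" for a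
    by (rule f2.frame_complete) (simp only: cinner_diff_left matrix, simp)
  then have on_frame: "T (\<Psi>1 a) = G (\<Psi>1 a) + U (\<Psi>1 a)" for a
    by simp
  have "bounded_clinear (\<lambda>x. G x + U x)"
    using \<open>bounded_clinear U\<close> bounded_clinear_sum_of_tensors[of xs] unfolding bounded_clinear_def xs
    by (simp add: bounded_linear_add scaleC_add_right)
  then have T_eq: "T x = U x + G x" for x
    using f1.bounded_clinear_eq_on_frame[OF T _ on_frame, of x] by (simp add: add.commute)
  show ?thesis
  proof (rule bessel_sum_in_schatten_class[OF T p])
    show "bessel_family (UNIV <+> {..<length xs}) (case_sum \<Psi>1 (\<lambda>l. fst (xs ! l)))
        (B + (1 + (\<Sum>l<length xs. (norm (fst (xs ! l)))\<^sup>2)))"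
      by (intro bessel_family_Plus u bessel_family_finite) simp
    have "case_sum (\<lambda>i. norm (h i) powr p) (\<lambda>l. norm (snd (xs ! l)) powr p) summable_on (UNIV <+> {..<length xs})"
      using has_sum_Plus[OF has_sum_infsum[OF h_powr] has_sum_finite] has_sum_imp_summable by blast
    moreover have "case_sum (\<lambda>i. norm (h i) powr p) (\<lambda>l. norm (snd (xs ! l)) powr p) =
        (\<lambda>k. norm (case_sum h (\<lambda>l. snd (xs ! l)) k) powr p)"
      by (auto simp: fun_eq_iff split: sum.split)
    ultimately show "(\<lambda>k. norm (case_sum h (\<lambda>l. snd (xs ! l)) k) powr p) summable_on (UNIV <+> {..<length xs})"
      by simp
    fix x
    have "(case_sum (\<lambda>i. cinner x (\<Psi>1 i) *\<^sub>C h i) (\<lambda>l. cinner x (fst (xs ! l)) *\<^sub>C snd (xs ! l)) has_sum T x)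
        (UNIV <+> {..<length xs})"
      unfolding T_eq xs sum_of_tensors_apply by (intro has_sum_Plus U has_sum_finite) simp
    moreover have "case_sum (\<lambda>i. cinner x (\<Psi>1 i) *\<^sub>C h i) (\<lambda>l. cinner x (fst (xs ! l)) *\<^sub>C snd (xs ! l)) =
        (\<lambda>k. cinner x (case_sum \<Psi>1 (\<lambda>l. fst (xs ! l)) k) *\<^sub>C case_sum h (\<lambda>l. snd (xs ! l)) k)"
      by (auto simp: fun_eq_iff split: sum.split)
    ultimately show "((\<lambda>k. cinner x (case_sum \<Psi>1 (\<lambda>l. fst (xs ! l)) k) *\<^sub>C case_sum h (\<lambda>l. snd (xs ! l)) k) has_sum T x)
        (UNIV <+> {..<length xs})"
      by simp
  qed
qed

theorem proposition4p6:
  fixes \<Psi>1 :: "'i::countable \<Rightarrow> 'a::complex_hilbert_space"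
    and \<Psi>2 :: "'j::countable \<Rightarrow> 'b::complex_hilbert_space"
    and \<A>1 :: "'i cmatrix set" and nrm1 :: "'i cmatrix \<Rightarrow> real"
    and \<A>2 :: "'j cmatrix set" and nrm2 :: "'j cmatrix \<Rightarrow> real"
    and T :: "'a \<Rightarrow> 'b"
    and K :: "(nat \<Rightarrow> ('a, 'b) tensor) set"
    and p :: real
  assumes "1 \<le> p" and "p \<le> 2"
    and "separable_space (euclidean :: 'a topology)"
    and "separable_space (euclidean :: 'b topology)"
    and "spectral_matrix_algebra \<A>1 nrm1" and "spectral_matrix_algebra \<A>2 nrm2"
    and "localised_frame \<A>1 \<Psi>1" and "localised_frame \<A>2 \<Psi>2"
    and "admissible_weight \<A>1 (\<lambda>_. 1)" and "admissible_weight \<A>2 (\<lambda>_. 1)"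
    and "bounded_clinear T"
    and "is_kernel \<Psi>1 \<Psi>2 T K"
  shows "(K \<in> H2p p \<Psi>1 \<Psi>2 \<longrightarrow> T \<in> schatten_class p) \<and>
         (K \<in> Hpp p \<Psi>1 \<Psi>2 \<longrightarrow> T \<in> schatten_class p)"
proof -
  have fr: "frame \<Psi>1" "frame \<Psi>2"
    using assms(7,8) by (auto simp: localised_frame_def frame_def)
  have schatten: "T \<in> schatten_class p"
    if K: "K \<in> coorbit_completion nrm \<Psi>1 \<Psi>2" and unit_ball: "\<And>c. nrm c < 1 \<Longrightarrow> c \<in> l2p_unit_ball p" for nrm
  proof -
    obtain G X where G: "G \<in> H00 \<Psi>1 \<Psi>2" and X: "\<And>n. nrm (X n) < 1"
      and lim: "\<And>i j. (\<lambda>n::nat. X n i j) \<longlonglongrightarrow> Hinf_coeff \<Psi>1 \<Psi>2 K i j - alg_coeff \<Psi>1 \<Psi>2 G i j"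
      using coorbit_completion_near_H00[OF K] by blast
    have "(\<lambda>i j. Hinf_coeff \<Psi>1 \<Psi>2 K i j - alg_coeff \<Psi>1 \<Psi>2 G i j) \<in> l2p_unit_ball p"
      by (rule l2p_unit_ball_limit[of X]) (use unit_ball X lim assms(1) in auto)
    then show ?thesis
      by (rule kernel_near_finite_rank_imp_schatten[OF fr assms(1,2,11,12) G])
  qed
  show ?thesis
    using schatten[of "l2p_norm p"] schatten[of "lpp_norm p"] assms(1,2)
      l2p_norm_less_one_imp_unit_ball lpp_norm_less_one_imp_unit_ball
    unfolding H2p_def Hpp_def by blast
qed

end
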